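(* For each real number $c>\frac32$ there exists a number $\mu_0(c)\in(0,1)$ such that $$\{(c,\mu)\ |\ c>\tfrac32,\ \mu\in(\mu_0(c),1)\}\subset\mathfrak{C},$$ where $\mathfrak{C}$ is the convexity range; that is, for every $c>\frac32$ and every $\mu\in(\mu_0(c),1)$ the energy surface $\Sigma_{\mu,c}\subset\mathbb{R}^4$ bounds a strongly convex domain. Here $\Sigma_{\mu,c}$ is the component around the earth of the zero level set of $$K_{\mu,c}(v,u)=\tfrac12|u|^2+2|v|^2\langle u,iv\rangle-\mu\,\mathrm{Im}(uv)-\frac{1-\mu}{2}-\frac{\mu|v|^2}{|2v^2-1|}+c|v|^2 .$$
   Context: **Planar restricted 3-body problem.** For $\mu\in(0,1)$ let $H=H_\mu:(\mathbb{C}\setminus\{0,1\})\times\mathbb{C}\to\mathbb{R}$, $$H(q,p)=\tfrac12|p|^2+\langle p,iq\rangle-\langle p,i\mu\rangle-\frac{1-\mu}{|q|}-\frac{\mu}{|q-1|},$$ where $\langle a,b\rangle=\mathrm{Re}(a\bar b)$ is the standard real inner product on $\mathbb{C}=\mathbb{R}^2$ (so $\langle p,iq\rangle=p_2q_1-p_1q_2$). The primary at $q=0$ (the "earth") has mass $1-\mu$ and the primary at $q=1$ (the "sun") has mass $\mu$. $H$ has five critical points $L_1,\dots,L_5$, ordered by increasing value of $H$; thus $H(L_1)$ is the smallest critical value. It converges to $-\frac32$ as $\mu\to1$. If $-c<H(L_1)$, then $H^{-1}(-c)$ has three connected components: one near $q=0$, one near $q=1$, one near infinity. **Levi-Civita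 regularization.** Substituting $q=2v^2$, $p=u/\bar v$ (a 2:1 map) gives $K_{\mu,c}=|v|^2(H+c)$, which is the displayed function of $(v,u)\in\mathbb{C}^2=\mathbb{R}^4$, $2v^2\neq1$. **The component $\Sigma_{\mu,c}$.** When $-c<H(L_1)$, $\Sigma_{\mu,c}$ is the compact connected component of $K_{\mu,c}^{-1}(0)$ to which the component of $H^{-1}(-c)$ near the earth $q=0$ lifts; equivalently, it is the connected component of $K_{\mu,c}^{-1}(0)$ containing the circle $\{v=0,\ |u|^2=1-\mu\}$. For fixed $c>\frac32$ the condition $-c<H(L_1)$ holds for all $\mu<1$ sufficiently close to $1$, and $\mu_0(c)$ is understood to be such that it holds for all $\mu\in(\mu_0(c),1)$. **Strong convexity.** A compact hypersurface $\Sigma\subset\mathbb{R}^4$ *bounds a strongly convex domain* if there exist a constant $\delta>0$ and a smooth convex function $C:\mathbb{R}^4\to\mathbb{R}$ such that $\Sigma=C^{-1}(1)$ and the matrix $D^2C(z)-\delta\,\mathrm{Id}$ is positive definite for all $z\in\mathbb{R}^4$. **Convexity range.** $\mathfrak{C}$ is the collection of all pairs $(c,\mu)$ with $c>\frac32$ and $\mu\in(0,1)$ such that $\Sigma_{\mu,c}$ bounds a strongly convex domain. *)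

theory Defs
  imports "HOL-Analysis.Analysis"
begin

unbundle inner_syntax

primrec C_diff_on :: "nat \<Rightarrow> 'a::euclidean_space set \<Rightarrow> ('a \<Rightarrow> real) \<Rightarrow> bool" where
  "C_diff_on 0 U f \<longleftrightarrow> continuous_on U f"
| "C_diff_on (Suc k) U f \<longleftrightarrow>
     (\<forall>x\<in>U. f differentiable (at x)) \<and>
     (\<forall>b\<in>Basis. C_diff_on k U (\<lambda>x. frechet_derivative f (at x) b))"

text \<open>Only meaningful for open \<open>U\<close>, since derivatives are taken in the full space.\<close>

definition smooth_on :: "'a::euclidean_space set \<Rightarrow> ('a \<Rightarrow> real) \<Rightarrow> bool" where
  "smooth_on U f \<longleftrightarrow> (\<forall>k. C_diff_on k U f)"

text \<open>The Hessian matrix, as the bilinear form \<open>(h, k) \<mapsto> \<langle>D\<^sup>2f(z) h, k\<rangle>\<close>.\<close>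

definition hessian :: "('a::euclidean_space \<Rightarrow> real) \<Rightarrow> 'a \<Rightarrow> 'a \<Rightarrow> 'a \<Rightarrow> real" where
  "hessian f z h k = frechet_derivative (\<lambda>x. frechet_derivative f (at x) h) (at z) k"

definition positive_definite :: "('a::euclidean_space \<Rightarrow> 'a \<Rightarrow> real) \<Rightarrow> bool" where
  "positive_definite B \<longleftrightarrow> (\<forall>h. h \<noteq> 0 \<longrightarrow> B h h > 0)"

definition smooth_hypersurface :: "'a::euclidean_space set \<Rightarrow> bool" where
  "smooth_hypersurface S \<longleftrightarrow>
     (\<forall>x\<in>S. \<exists>U f. open U \<and> x \<in> U \<and> smooth_on U f \<and>
        (\<forall>y\<in>U. frechet_derivative f (at y) \<noteq> (\<lambda>_. 0)) \<and>
        S \<inter> U = {y \<in> U. f y = 0})"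

text \<open>In \<open>positive_definite\<close> below, \<open>(h, k) \<mapsto> \<delta> * (h \<bullet> k)\<close> is the form of the matrix \<open>\<delta> Id\<close>.\<close>

definition bounds_strongly_convex_domain :: "'a::euclidean_space set \<Rightarrow> bool" where
  "bounds_strongly_convex_domain S \<longleftrightarrow>
     compact S \<and> smooth_hypersurface S \<and>
     (\<exists>\<delta>>0. \<exists>C. smooth_on UNIV C \<and> convex_on UNIV C \<and> S = C -` {1} \<and>
        (\<forall>z. positive_definite (\<lambda>h k. hessian C z h k - \<delta> * (h \<bullet> k))))"

text \<open>Phase space is \<open>complex \<times> complex\<close>, whose product inner product is the standard one
  of \<open>\<real>\<^sup>4\<close>. Points are \<open>(q, p)\<close> before and \<open>(v, u)\<close> after regularization.\<close>

definition H :: "real \<Rightarrow> complex \<times> complex \<Rightarrow> real" where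
  "H \<mu> = (\<lambda>(q, p).
     (cmod p)\<^sup>2 / 2 + p \<bullet> (\<i> * q) - p \<bullet> (\<i> * of_real \<mu>)
     - (1 - \<mu>) / cmod q - \<mu> / cmod (q - 1))"

definition critical_points :: "real \<Rightarrow> (complex \<times> complex) set" where
  "critical_points \<mu> =
     {z \<in> (- {0, 1}) \<times> UNIV. (H \<mu> has_derivative (\<lambda>_. 0)) (at z)}"

text \<open>\<open>H \<mu>\<close> has five critical points, so the infimum is attained; it is the value at \<open>L\<^sub>1\<close>.\<close>

definition H_L1 :: "real \<Rightarrow> real" where
  "H_L1 \<mu> = Inf (H \<mu> ` critical_points \<mu>)"

definition K :: "real \<Rightarrow> real \<Rightarrow> complex \<times> complex \<Rightarrow> real" where
  "K \<mu> c = (\<lambda>(v, u).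
     (cmod u)\<^sup>2 / 2 + 2 * (cmod v)\<^sup>2 * (u \<bullet> (\<i> * v)) - \<mu> * Im (u * v)
     - (1 - \<mu>) / 2 - \<mu> * (cmod v)\<^sup>2 / cmod (2 * v\<^sup>2 - 1) + c * (cmod v)\<^sup>2)"

lemma K_eq_regularized_H:
  assumes "v \<noteq> 0"
  shows "K \<mu> c (v, u) = (cmod v)\<^sup>2 * (H \<mu> (2 * v\<^sup>2, u / cnj v) + c)"
proof -
  define p where "p = u / cnj v"
  have u: "u = p * cnj v"
    using assms by (simp add: p_def)
  have 1: "(cmod u)\<^sup>2 = (cmod v)\<^sup>2 * (cmod p)\<^sup>2"
    by (simp add: u norm_mult power_mult_distrib)
  have "2 * (u \<bullet> (\<i> * v)) = p \<bullet> (\<i> * (2 * v\<^sup>2))"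
    by (simp add: u inner_complex_def power2_eq_square algebra_simps)
  then have 2: "2 * (cmod v)\<^sup>2 * (u \<bullet> (\<i> * v)) = (cmod v)\<^sup>2 * (p \<bullet> (\<i> * (2 * v\<^sup>2)))"
    by (metis mult.assoc mult.commute)
  have 3: "\<mu> * Im (u * v) = (cmod v)\<^sup>2 * (p \<bullet> (\<i> * of_real \<mu>))"
    unfolding cmod_power2 by (simp add: u inner_complex_def power2_eq_square algebra_simps)
  have 4: "(1 - \<mu>) / 2 = (cmod v)\<^sup>2 * ((1 - \<mu>) / cmod (2 * v\<^sup>2))"
    using assms by (simp add: norm_mult norm_power)
  have split: "k * (P / 2 + X - Y - Z - m / d + c) =
      k * P / 2 + k * X - k * Y - k * Z - m * k / d + c * k" for k P X Y Z m d :: real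
    by (simp add: algebra_simps)
  show ?thesis
    unfolding p_def[symmetric] K_def H_def prod.case 1 2 3 4 by (rule split[symmetric])
qed

definition K_zero_set :: "real \<Rightarrow> real \<Rightarrow> (complex \<times> complex) set" where
  "K_zero_set \<mu> c = {(v, u). 2 * v\<^sup>2 \<noteq> 1 \<and> K \<mu> c (v, u) = 0}"

definition collision_circle :: "real \<Rightarrow> (complex \<times> complex) set" where
  "collision_circle \<mu> = {(v, u). v = 0 \<and> (cmod u)\<^sup>2 = 1 - \<mu>}"

definition Sigma_comp :: "real \<Rightarrow> real \<Rightarrow> (complex \<times> complex) set" where
  "Sigma_comp \<mu> c =
     (THE S. S \<in> components (K_zero_set \<mu> c) \<and> collision_circle \<mu> \<subseteq> S)"

lemma collision_circle_eq:
  assumes "\<mu> < 1"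
  shows "collision_circle \<mu> = {0} \<times> sphere 0 (sqrt (1 - \<mu>))"
proof -
  have iff: "(cmod u)\<^sup>2 = 1 - \<mu> \<longleftrightarrow> cmod u = sqrt (1 - \<mu>)" for u
  proof
    show "cmod u = sqrt (1 - \<mu>)" if "(cmod u)\<^sup>2 = 1 - \<mu>"
      by (simp add: that[symmetric])
    show "(cmod u)\<^sup>2 = 1 - \<mu>" if "cmod u = sqrt (1 - \<mu>)"
      using assms by (simp add: that)
  qed
  show ?thesis
    unfolding collision_circle_def iff by auto
qed

lemma Sigma_comp_unique:
  assumes "\<mu> < 1"
  shows "\<exists>!S. S \<in> components (K_zero_set \<mu> c) \<and> collision_circle \<mu> \<subseteq> S"
proof -
  let ?Z = "K_zero_set \<mu> c" and ?C = "collision_circle \<mu>"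
  have conn: "connected ?C"
    unfolding collision_circle_eq[OF assms]
    by (intro connected_Times connected_sing connected_sphere) simp
  have sub: "?C \<subseteq> ?Z"
    by (auto simp: collision_circle_def K_zero_set_def K_def)
  have "(0, of_real (sqrt (1 - \<mu>))) \<in> ?C"
    using assms by (simp add: collision_circle_def)
  then have ne: "?C \<noteq> {}"
    by blast
  have "?Z \<noteq> {}"
    using sub ne by blast
  from exists_component_superset[OF sub this conn]
  obtain S where S: "S \<in> components ?Z" "?C \<subseteq> S"
    by (elim exE conjE)
  show ?thesis
  proof (rule ex1I)
    show "S \<in> components ?Z \<and> ?C \<subseteq> S"
      by (rule conjI[OF S])
  next
    fix T
    assume T: "T \<in> components ?Z \<and> ?C \<subseteq> T"
    have "T \<inter> S \<noteq> {}"
      using S(2) conjunct2[OF T] ne by blast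
    then show "T = S"
      by (rule components_eq[OF conjunct1[OF T] S(1), THEN iffD2])
  qed
qed

lemma Sigma_comp:
  assumes "\<mu> < 1"
  shows "Sigma_comp \<mu> c \<in> components (K_zero_set \<mu> c)"
    and "collision_circle \<mu> \<subseteq> Sigma_comp \<mu> c"
  unfolding Sigma_comp_def
  by (rule theI'[OF Sigma_comp_unique[OF assms, of c], THEN conjunct1],
      rule theI'[OF Sigma_comp_unique[OF assms, of c], THEN conjunct2])

text \<open>\<open>Sigma_comp \<mu> c\<close> is the energy surface around the earth only below the first critical
  value, so that condition is part of membership in the convexity range.\<close>

definition convexity_range :: "(real \<times> real) set" where
  "convexity_range =
     {(c, \<mu>). c > 3/2 \<and> 0 < \<mu> \<and> \<mu> < 1 \<and> - c < H_L1 \<mu> \<and>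
        bounds_strongly_convex_domain (Sigma_comp \<mu> c)}"

end

theory Submission
  imports Defs "HOL-Real_Asymp.Real_Asymp"
begin

text \<open>Write \<open>K \<mu> c = Q - (1 - \<mu>) / 2 + R\<close>, where \<open>Q\<close> is quadratic and \<open>R\<close> has order four at the origin.
  For \<open>c > 3/2\<close> the form \<open>Q\<close> is positive definite, uniformly in \<open>\<mu> \<in> [0, 1]\<close>. Multiplying \<open>R\<close> by
  a bump function supported in a ball of small radius \<open>r\<close> makes its Hessian small everywhere, so
  \<open>1 + Q - (1 - \<mu>) / 2 + cutoff * R\<close> is smooth, even and strongly convex on all of \<open>\<real>\<^sup>4\<close>. Its level
  set at 1 is a sphere of diameter \<open>O(sqrt (1 - \<mu>))\<close>, hence for \<open>\<mu>\<close> near 1 it lies in the region where the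
  bump function is 1; there it is both open and closed in the zero set of \<open>K \<mu> c\<close>.

  A critical value of \<open>H \<mu>\<close> is a value of \<open>- U\<close> with \<open>U q = |q - \<mu>|\<^sup>2 / 2 + (1 - \<mu>) / |q| + \<mu> / |q - 1|\<close>. Off the real axis
  criticality forces \<open>|q| = |q - 1| = 1\<close>. On each of the three intervals of the real axis \<open>U\<close> is
  convex, so its critical value there is at most its value at any test point, and suitable test
  values tend to \<open>3/2\<close> as \<open>\<mu>\<close> tends to 1.\<close>

section \<open>Smooth functions\<close>

lemma C_diff_on_cong:
  assumes "open U" "\<And>x. x \<in> U \<Longrightarrow> f x = g x"
  shows "C_diff_on k U f \<longleftrightarrow> C_diff_on k U g"
  using assms(2)
proof (induction k arbitrary: f g)
  case 0
  then show ?case by (simp cong: continuous_on_cong)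
next
  case (Suc k)
  have der: "(f has_derivative f') (at x) \<longleftrightarrow> (g has_derivative f') (at x)" if "x \<in> U" for x f'
    using has_derivative_transform_within_open[OF _ assms(1) that] Suc.prems by metis
  then have "f differentiable (at x) \<longleftrightarrow> g differentiable (at x)" if "x \<in> U" for x
    using that by (simp add: differentiable_def)
  moreover have eq: "frechet_derivative f (at x) = frechet_derivative g (at x)" if "x \<in> U" for x
    using der[OF that] by (simp add: frechet_derivative_def)
  moreover have "C_diff_on k U (\<lambda>x. frechet_derivative f (at x) b) \<longleftrightarrow>
      C_diff_on k U (\<lambda>x. frechet_derivative g (at x) b)" for b
    by (rule Suc.IH) (simp add: eq)
  ultimately show ?case unfolding C_diff_on.simps by blast
qed

text \<open>Lets an explicit formula for the derivative stand in for
  \<open>frechet_derivative\<close>, so that each closure property below reduces to its rule of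
  differentiation and an induction on the order.\<close>

lemma C_diff_on_SucI:
  assumes "open U" "\<And>x. x \<in> U \<Longrightarrow> (f has_derivative f' x) (at x)"
    and "\<And>b. b \<in> Basis \<Longrightarrow> C_diff_on k U (\<lambda>x. f' x b)"
  shows "C_diff_on (Suc k) U f"
proof -
  have "frechet_derivative f (at x) = f' x" if "x \<in> U" for x
    using frechet_derivative_at[OF assms(2)[OF that]] by simp
  then have "C_diff_on k U (\<lambda>x. frechet_derivative f (at x) b)" if "b \<in> Basis" for b
    using C_diff_on_cong[OF assms(1), of "\<lambda>x. frechet_derivative f (at x) b" "\<lambda>x. f' x b" k]
      assms(3)[OF that] by simp
  moreover have "f differentiable (at x)" if "x \<in> U" for x
    using assms(2)[OF that] by (rule differentiableI)
  ultimately show ?thesis by simp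
qed

lemma C_diff_on_SucD:
  assumes "C_diff_on (Suc k) U f"
  shows "x \<in> U \<Longrightarrow> (f has_derivative frechet_derivative f (at x)) (at x)"
    and "b \<in> Basis \<Longrightarrow> C_diff_on k U (\<lambda>x. frechet_derivative f (at x) b)"
  using assms by (simp_all add: frechet_derivative_works)

lemma C_diff_on_Suc_imp: "C_diff_on (Suc k) U f \<Longrightarrow> C_diff_on k U f"
proof (induction k arbitrary: f)
  case 0
  then show ?case
    by (simp add: continuous_at_imp_continuous_on differentiable_imp_continuous_within)
next
  case (Suc k)
  show ?case
    using Suc.prems Suc.IH[OF C_diff_on_SucD(2)[OF Suc.prems]] by simp
qed

lemma C_diff_on_Un:
  assumes "open U" "open V" "C_diff_on k U f" "C_diff_on k V f"
  shows "C_diff_on k (U \<union> V) f"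
  using assms(3,4)
proof (induction k arbitrary: f)
  case 0
  then show ?case using continuous_on_open_Un[OF assms(1,2)] by simp
next
  case (Suc k)
  then show ?case unfolding C_diff_on.simps by blast
qed

lemma C_diff_on_subset: "C_diff_on k U f \<Longrightarrow> V \<subseteq> U \<Longrightarrow> C_diff_on k V f"
proof (induction k arbitrary: f)
  case 0
  then show ?case using continuous_on_subset by auto
next
  case (Suc k)
  then show ?case unfolding C_diff_on.simps by blast
qed

lemma C_diff_on_const: "C_diff_on k U (\<lambda>x. c)"
proof (induction k arbitrary: c)
  case (Suc k)
  have "frechet_derivative (\<lambda>x. c) (at x) = (\<lambda>_. 0)" for x :: 'a
    by (metis frechet_derivative_const)
  with Suc show ?case by simp
qed simp

lemma C_diff_on_bounded_linear:
  assumes "open U" "bounded_linear f"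
  shows "C_diff_on k U f"
proof (cases k)
  case 0
  then show ?thesis using assms(2) by (simp add: linear_continuous_on)
next
  case (Suc n)
  show ?thesis
    unfolding Suc
    by (rule C_diff_on_SucI[OF assms(1), where f'="\<lambda>_. f"])
      (rule bounded_linear_imp_has_derivative[OF assms(2)] C_diff_on_const)+
qed

lemma C_diff_on_add:
  assumes "open U" "C_diff_on k U f" "C_diff_on k U g"
  shows "C_diff_on k U (\<lambda>x. f x + g x)"
  using assms(2,3)
proof (induction k arbitrary: f g)
  case 0
  then show ?case by (simp add: continuous_on_add)
next
  case (Suc k)
  note D = C_diff_on_SucD[OF Suc.prems(1)] C_diff_on_SucD[OF Suc.prems(2)]
  show ?case
    by (rule C_diff_on_SucI[OF assms(1)], rule has_derivative_add, (rule D; assumption)+)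
      (intro Suc.IH D)
qed

lemma C_diff_on_mult:
  assumes "open U" "C_diff_on k U f" "C_diff_on k U g"
  shows "C_diff_on k U (\<lambda>x. f x * g x)"
  using assms(2,3)
proof (induction k arbitrary: f g)
  case 0
  then show ?case by (simp add: continuous_on_mult)
next
  case (Suc k)
  note D = C_diff_on_SucD[OF Suc.prems(1)] C_diff_on_SucD[OF Suc.prems(2)]
  show ?case
    by (rule C_diff_on_SucI[OF assms(1)], rule has_derivative_mult, (rule D; assumption)+)
      (intro C_diff_on_add Suc.IH C_diff_on_Suc_imp[OF Suc.prems(1)]
        C_diff_on_Suc_imp[OF Suc.prems(2)] D assms(1))
qed

lemma C_diff_on_sum:
  assumes "open U" "\<And>i. i \<in> I \<Longrightarrow> C_diff_on k U (f i)"
  shows "C_diff_on k U (\<lambda>x. \<Sum>i\<in>I. f i x)"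
  using assms(2)
  by (induction I rule: infinite_finite_induct) (auto intro: C_diff_on_const C_diff_on_add assms(1))

lemma frechet_derivative_Basis:
  fixes f :: "'a::euclidean_space \<Rightarrow> real"
  assumes "f differentiable (at x)"
  shows "frechet_derivative f (at x) h = (\<Sum>b\<in>Basis. (h \<bullet> b) * frechet_derivative f (at x) b)"
proof -
  interpret linear "frechet_derivative f (at x)"
    using assms by (rule linear_frechet_derivative)
  have "frechet_derivative f (at x) h = frechet_derivative f (at x) (\<Sum>b\<in>Basis. (h \<bullet> b) *\<^sub>R b)"
    by (simp add: euclidean_representation)
  then show ?thesis by (simp add: sum scaleR)
qed

text \<open>The definition controls basis directions only; linearity of the derivative gives the
  others. Arbitrary directions occur in \<open>hessian\<close> and after composition with a linear
  map.\<close>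

lemma C_diff_on_directional:
  assumes "open U" "C_diff_on (Suc k) U f"
  shows "C_diff_on k U (\<lambda>x. frechet_derivative f (at x) h)"
proof -
  have "C_diff_on k U (\<lambda>x. \<Sum>b\<in>Basis. (h \<bullet> b) * frechet_derivative f (at x) b)"
    by (intro C_diff_on_sum C_diff_on_mult C_diff_on_const C_diff_on_SucD(2)[OF assms(2)] assms(1))
  moreover have "frechet_derivative f (at x) h = (\<Sum>b\<in>Basis. (h \<bullet> b) * frechet_derivative f (at x) b)"
    if "x \<in> U" for x
    using assms(2) that by (intro frechet_derivative_Basis) simp
  ultimately show ?thesis
    using C_diff_on_cong[OF assms(1), of "\<lambda>x. frechet_derivative f (at x) h"] by simp
qed

text \<open>The inner map is vector-valued, so the scalar notion does not apply to it. The chain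
  rule yields a directional derivative of \<open>f\<close> after the same affine map, which keeps
  the induction closed.\<close>

lemma C_diff_on_affine:
  fixes f :: "'b::euclidean_space \<Rightarrow> real" and L :: "'a::euclidean_space \<Rightarrow> 'b"
  assumes "open U" "open V" "bounded_linear L" "\<And>x. x \<in> V \<Longrightarrow> a + L x \<in> U" "C_diff_on k U f"
  shows "C_diff_on k V (\<lambda>x. f (a + L x))"
  using assms(5)
proof (induction k arbitrary: f)
  case 0
  have "continuous_on V (\<lambda>x. a + L x)"
    using assms(3) by (intro continuous_intros linear_continuous_on)
  then show ?case
    using 0 assms(4) by (auto intro!: continuous_on_compose2[of U f V "\<lambda>x. a + L x"])
next
  case (Suc k)
  show ?case
  proof (rule C_diff_on_SucI[OF assms(2)])
    fix x assume x: "x \<in> V"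
    have "((\<lambda>x. a + L x) has_derivative L) (at x)"
      using has_derivative_add[OF has_derivative_const bounded_linear_imp_has_derivative[OF assms(3)]]
      by simp
    from has_derivative_compose[OF this C_diff_on_SucD(1)[OF Suc.prems assms(4)[OF x]]]
    show "((\<lambda>x. f (a + L x)) has_derivative
        (\<lambda>h. frechet_derivative f (at (a + L x)) (L h))) (at x)" .
  next
    fix b :: 'a
    show "C_diff_on k V (\<lambda>x. frechet_derivative f (at (a + L x)) (L b))"
      by (rule Suc.IH[OF C_diff_on_directional[OF assms(1) Suc.prems]])
  qed
qed

lemma C_diff_on_compose:
  fixes g :: "real \<Rightarrow> real"
  assumes "open U" "open V" "\<And>x. x \<in> U \<Longrightarrow> f x \<in> V" "C_diff_on k V g" "C_diff_on k U f"
  shows "C_diff_on k U (\<lambda>x. g (f x))"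
  using assms(3,4,5)
proof (induction k arbitrary: f g)
  case 0
  then show ?case
    by (simp add: continuous_on_compose2[of V g U f] image_subset_iff)
next
  case (Suc k)
  show ?case
  proof (rule C_diff_on_SucI[OF assms(1)])
    fix x assume x: "x \<in> U"
    have "(g has_derivative frechet_derivative g (at (f x))) (at (f x))"
      by (rule C_diff_on_SucD(1)[OF Suc.prems(2) Suc.prems(1)[OF x]])
    moreover from this
    \<comment> \<open>A linear map on the reals is multiplication by its value at 1. This turns the
      chain rule into a product of scalar functions.\<close>
    have "frechet_derivative g (at (f x)) = (\<lambda>h. h * frechet_derivative g (at (f x)) 1)"
      by (intro ext, subst frechet_derivative_Basis[OF differentiableI]) simp_all
    ultimately have "(g has_derivative (\<lambda>h. h * frechet_derivative g (at (f x)) 1)) (at (f x))"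
      by (rule has_derivative_eq_rhs)
    from has_derivative_compose[OF C_diff_on_SucD(1)[OF Suc.prems(3) x] this]
    show "((\<lambda>x. g (f x)) has_derivative
        (\<lambda>h. frechet_derivative f (at x) h * frechet_derivative g (at (f x)) 1)) (at x)" .
  next
    fix b :: 'a assume b: "b \<in> Basis"
    have "C_diff_on k V (\<lambda>y. frechet_derivative g (at y) 1)"
      by (rule C_diff_on_SucD(2)[OF Suc.prems(2)]) simp
    from Suc.IH[OF Suc.prems(1) this C_diff_on_Suc_imp[OF Suc.prems(3)]]
    show "C_diff_on k U (\<lambda>x. frechet_derivative f (at x) b * frechet_derivative g (at (f x)) 1)"
      by (intro C_diff_on_mult assms(1) C_diff_on_SucD(2)[OF Suc.prems(3) b])
  qed
qed

lemma C_diff_on_real_SucI: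
  fixes g :: "real \<Rightarrow> real"
  assumes "open V" "\<And>x. x \<in> V \<Longrightarrow> (g has_real_derivative g' x) (at x)" "C_diff_on k V g'"
  shows "C_diff_on (Suc k) V g"
proof (rule C_diff_on_SucI[OF assms(1)])
  show "(g has_derivative (*) (g' x)) (at x)" if "x \<in> V" for x
    using assms(2)[OF that] by (simp add: has_field_derivative_def)
  show "C_diff_on k V (\<lambda>x. g' x * b)" if "b \<in> Basis" for b :: real
    using that assms(3) by simp
qed

text \<open>Up to constant factors, real powers are closed under differentiation. Exponent -1 serves
  the quotient in \<open>cutoff\<close>, exponent -1/2 the inverse modulus in
  \<open>potential_part\<close>.\<close>

lemma smooth_on_powr: "smooth_on {0<..} (\<lambda>x::real. x powr p)"
proof -
  have "C_diff_on k {0<..} (\<lambda>x::real. x powr p)" for k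
  proof (induction k arbitrary: p)
    case 0
    have "continuous_on {0<..} (\<lambda>x::real. x powr p)"
      by (intro continuous_on_powr continuous_on_id continuous_on_const) auto
    then show ?case by simp
  next
    case (Suc k)
    have "((\<lambda>x. x powr p) has_real_derivative p * x powr (p - 1)) (at x)" if "x \<in> {0<..}" for x :: real
      using that by (intro has_real_derivative_powr) simp
    moreover have "C_diff_on k {0<..} (\<lambda>x. p * x powr (p - 1))"
      by (intro C_diff_on_mult C_diff_on_const Suc.IH open_greaterThan)
    ultimately show ?case
      by (intro C_diff_on_real_SucI[OF open_greaterThan])
  qed
  then show ?thesis by (simp add: smooth_on_def)
qed

section \<open>Closure properties of smooth functions, obtained order by order\<close>

lemma smooth_on_cong: "open U \<Longrightarrow> (\<And>x. x \<in> U \<Longrightarrow> f x = g x) \<Longrightarrow> smooth_on U f \<longleftrightarrow> smooth_on U g"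
  unfolding smooth_on_def using C_diff_on_cong by blast

lemma smooth_on_subset: "smooth_on U f \<Longrightarrow> V \<subseteq> U \<Longrightarrow> smooth_on V f"
  unfolding smooth_on_def using C_diff_on_subset by blast

lemma smooth_on_Un: "open U \<Longrightarrow> open V \<Longrightarrow> smooth_on U f \<Longrightarrow> smooth_on V f \<Longrightarrow> smooth_on (U \<union> V) f"
  unfolding smooth_on_def using C_diff_on_Un by blast

lemma smooth_on_const: "smooth_on U (\<lambda>x. c)"
  unfolding smooth_on_def using C_diff_on_const by blast

lemma smooth_on_bounded_linear: "open U \<Longrightarrow> bounded_linear f \<Longrightarrow> smooth_on U f"
  unfolding smooth_on_def using C_diff_on_bounded_linear by blast

lemma smooth_on_add: "open U \<Longrightarrow> smooth_on U f \<Longrightarrow> smooth_on U g \<Longrightarrow> smooth_on U (\<lambda>x. f x + g x)"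
  unfolding smooth_on_def using C_diff_on_add by blast

lemma smooth_on_mult: "open U \<Longrightarrow> smooth_on U f \<Longrightarrow> smooth_on U g \<Longrightarrow> smooth_on U (\<lambda>x. f x * g x)"
  unfolding smooth_on_def using C_diff_on_mult by blast

lemma smooth_on_diff:
  assumes "open U" "smooth_on U f" "smooth_on U g"
  shows "smooth_on U (\<lambda>x. f x - g x)"
  using smooth_on_add[OF assms(1,2) smooth_on_mult[OF assms(1) smooth_on_const[of _ "-1"] assms(3)]]
  by simp

lemma smooth_on_power: "open U \<Longrightarrow> smooth_on U f \<Longrightarrow> smooth_on U (\<lambda>x. f x ^ n)"
  by (induction n) (simp_all add: smooth_on_const smooth_on_mult)

lemmas smooth_on_intros =
  smooth_on_const smooth_on_add smooth_on_diff smooth_on_mult smooth_on_power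

lemma smooth_on_compose:
  fixes g :: "real \<Rightarrow> real"
  assumes "smooth_on V g" "smooth_on U f" "open U" "open V" "\<And>x. x \<in> U \<Longrightarrow> f x \<in> V"
  shows "smooth_on U (\<lambda>x. g (f x))"
  using assms(1,2) C_diff_on_compose[where f=f, OF assms(3-5)] unfolding smooth_on_def by blast

lemma smooth_on_affine:
  assumes "smooth_on U f" "open U" "bounded_linear L" "\<And>x. a + L x \<in> U"
  shows "smooth_on UNIV (\<lambda>x. f (a + L x))"
  using assms(1) C_diff_on_affine[OF assms(2) open_UNIV assms(3,4)] unfolding smooth_on_def by blast

lemma smooth_on_imp_continuous_on: "smooth_on U f \<Longrightarrow> continuous_on U f"
  unfolding smooth_on_def using C_diff_on.simps(1) by blast

lemma smooth_on_has_derivative: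
  assumes "smooth_on U f" "x \<in> U"
  shows "(f has_derivative frechet_derivative f (at x)) (at x)"
  using assms C_diff_on_SucD(1) unfolding smooth_on_def by blast

lemma smooth_on_directional:
  "open U \<Longrightarrow> smooth_on U f \<Longrightarrow> smooth_on U (\<lambda>x. frechet_derivative f (at x) h)"
  unfolding smooth_on_def using C_diff_on_directional by blast

section \<open>A smooth cutoff function\<close>

lemma poly_mult_exp_minus_tendsto_0: "((\<lambda>y::real. poly p y * exp (- y)) \<longlongrightarrow> 0) at_top"
proof -
  have "((\<lambda>y. \<Sum>i\<le>degree p. coeff p i * (y ^ i / exp y)) \<longlongrightarrow> (\<Sum>i\<le>degree p. coeff p i * 0)) at_top"
    by (intro tendsto_sum tendsto_mult tendsto_const tendsto_power_div_exp_0)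
  then show ?thesis
    by (simp add: poly_altdef sum_distrib_right exp_minus divide_inverse mult.assoc)
qed

text \<open>The classical flat function exp(-1/x), extended by 0, is the case \<open>p = 1\<close>.
  A polynomial factor in 1/x makes the family closed under differentiation.\<close>

definition flat_poly :: "real poly \<Rightarrow> real \<Rightarrow> real" where
  "flat_poly p x = (if x > 0 then poly p (1 / x) * exp (- (1 / x)) else 0)"

lemma flat_poly_tendsto_0: "(flat_poly p \<longlongrightarrow> 0) (at_right 0)"
proof -
  have "((\<lambda>x. poly p (1 / x) * exp (- (1 / x))) \<longlongrightarrow> 0) (at_right 0)"
    using filterlim_compose[OF poly_mult_exp_minus_tendsto_0 filterlim_inverse_at_top_right, of p]
    by (simp add: inverse_eq_divide)
  then show ?thesis
    by (rule Lim_transform_eventually)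
      (auto simp: flat_poly_def eventually_at_right_less intro: eventually_mono[OF eventually_at_right_less])
qed

text \<open>For y = 1/x the chain rule turns p(y) exp(-y) into y^2 (p(y) - p'(y)) exp(-y); the
  factor \<open>[:0, 0, 1:]\<close> is y^2.\<close>

lemma flat_poly_has_real_derivative:
  "(flat_poly p has_real_derivative flat_poly ([:0, 0, 1:] * (p - pderiv p)) x) (at x)"
proof -
  consider "x > 0" | "x < 0" | "x = 0" by linarith
  then show ?thesis
  proof cases
    case 1
    have "((\<lambda>x. poly p (1 / x) * exp (- (1 / x))) has_real_derivative
        flat_poly ([:0, 0, 1:] * (p - pderiv p)) x) (at x)"
      using 1 by (auto intro!: derivative_eq_intros DERIV_chain2[OF poly_DERIV]
          simp: flat_poly_def field_simps power2_eq_square)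
    then show ?thesis
      by (rule has_field_derivative_transform_within_open[where S="{0<..}"])
        (use 1 in \<open>auto simp: flat_poly_def\<close>)
  next
    case 2
    have "((\<lambda>_. 0) has_real_derivative flat_poly ([:0, 0, 1:] * (p - pderiv p)) x) (at x)"
      using 2 by (simp add: flat_poly_def)
    then show ?thesis
      by (rule has_field_derivative_transform_within_open[where S="{..<0}"])
        (use 2 in \<open>auto simp: flat_poly_def\<close>)
  next
    case 3
    \<comment> \<open>Dividing by \<open>h\<close> adds a factor 1/h, that is, replaces
      \<open>p\<close> by \<open>pCons 0 p\<close>; flatness then gives derivative 0 at the
      origin.\<close>
    have "((\<lambda>h. flat_poly p h / h) \<longlongrightarrow> 0) (at_right 0)"
      by (rule Lim_transform_eventually[OF flat_poly_tendsto_0[of "pCons 0 p"]],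
          rule eventually_mono[OF eventually_at_right_less])
        (auto simp: flat_poly_def)
    moreover have "((\<lambda>h. flat_poly p h / h) \<longlongrightarrow> 0) (at_left 0)"
      by (rule tendsto_eventually) (auto simp: flat_poly_def eventually_at_left_field intro: exI[of _ "-1"])
    ultimately show ?thesis
      unfolding 3 DERIV_def by (simp add: filterlim_split_at flat_poly_def)
  qed
qed

lemma smooth_on_flat_poly: "smooth_on UNIV (flat_poly p)"
proof -
  have "C_diff_on k UNIV (flat_poly p)" for k
  proof (induction k arbitrary: p)
    case 0
    show ?case
      unfolding C_diff_on.simps
      using DERIV_isCont[OF flat_poly_has_real_derivative] by (intro continuous_at_imp_continuous_on) blast
  next
    case (Suc k)
    show ?case
      by (rule C_diff_on_real_SucI[OF open_UNIV flat_poly_has_real_derivative Suc.IH])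
  qed
  then show ?thesis by (simp add: smooth_on_def)
qed

text \<open>The denominator is positive because 2 - t and t - 1 are never both nonpositive. The
  argument will be a squared norm, so the transition lies between norms 1 and sqrt 2.\<close>

definition cutoff :: "real \<Rightarrow> real" where
  "cutoff t = flat_poly 1 (2 - t) / (flat_poly 1 (2 - t) + flat_poly 1 (t - 1))"

lemma cutoff_eq_1: "t \<le> 1 \<Longrightarrow> cutoff t = 1"
  and cutoff_eq_0: "t \<ge> 2 \<Longrightarrow> cutoff t = 0"
  by (simp_all add: cutoff_def flat_poly_def)

lemma smooth_on_cutoff: "smooth_on UNIV cutoff"
proof -
  let ?d = "\<lambda>t::real. flat_poly 1 (2 - t) + flat_poly 1 (t - 1)"
  have id: "smooth_on UNIV (\<lambda>t::real. t)"
    by (intro smooth_on_bounded_linear bounded_linear_ident open_UNIV)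
  have flat: "smooth_on UNIV (\<lambda>t. flat_poly 1 (2 - t))" "smooth_on UNIV (\<lambda>t. flat_poly 1 (t - 1))"
    by (rule smooth_on_compose[OF smooth_on_flat_poly]; intro smooth_on_intros id open_UNIV UNIV_I)+
  have pos: "?d t > 0" for t
    by (auto simp: flat_poly_def intro: add_pos_pos)
  have "smooth_on UNIV (\<lambda>t. ?d t powr (-1))"
    by (rule smooth_on_compose[OF smooth_on_powr, of UNIV ?d "-1"])
      (use pos in \<open>auto intro: smooth_on_add flat\<close>)
  from smooth_on_mult[OF open_UNIV flat(1) this] show ?thesis
    by (simp add: cutoff_def[abs_def] powr_minus pos less_imp_le divide_inverse)
qed

section \<open>Hessians\<close>

lemma frechet_derivative_affine:
  assumes "smooth_on U f" "bounded_linear L" "a + L x \<in> U"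
  shows "frechet_derivative (\<lambda>x. f (a + L x)) (at x) h = frechet_derivative f (at (a + L x)) (L h)"
proof -
  have "((\<lambda>x. a + L x) has_derivative L) (at x)"
    using has_derivative_add[OF has_derivative_const bounded_linear_imp_has_derivative[OF assms(2)]]
    by simp
  from has_derivative_compose[OF this smooth_on_has_derivative[OF assms(1,3)]]
  have "((\<lambda>x. f (a + L x)) has_derivative (\<lambda>h. frechet_derivative f (at (a + L x)) (L h))) (at x)" .
  from frechet_derivative_at[OF this, THEN fun_cong, of h] show ?thesis by simp
qed

lemma hessian_affine:
  assumes "smooth_on U f" "open U" "bounded_linear L" "\<And>x. a + L x \<in> U"
  shows "hessian (\<lambda>x. f (a + L x)) z h k = hessian f (a + L z) (L h) (L k)"
  unfolding hessian_def frechet_derivative_affine[OF assms(1,3,4)]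
  by (rule frechet_derivative_affine[OF smooth_on_directional[OF assms(2,1)] assms(3,4)])

lemma frechet_derivative_add_smooth:
  assumes "smooth_on U f" "smooth_on U g" "x \<in> U"
  shows "frechet_derivative (\<lambda>x. f x + g x) (at x) h = frechet_derivative f (at x) h + frechet_derivative g (at x) h"
  using frechet_derivative_at[OF has_derivative_add[OF smooth_on_has_derivative[OF assms(1,3)]
        smooth_on_has_derivative[OF assms(2,3)]], THEN fun_cong, of h] by simp

lemma frechet_derivative_cmult_smooth:
  assumes "smooth_on U f" "x \<in> U"
  shows "frechet_derivative (\<lambda>x. c * f x) (at x) h = c * frechet_derivative f (at x) h"
  using frechet_derivative_at[OF has_derivative_mult_right[OF smooth_on_has_derivative[OF assms], of c], THEN fun_cong, of h]
  by simp

lemma hessian_add: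
  assumes "smooth_on UNIV f" "smooth_on UNIV g"
  shows "hessian (\<lambda>x. f x + g x) z h k = hessian f z h k + hessian g z h k"
  unfolding hessian_def frechet_derivative_add_smooth[OF assms UNIV_I]
  by (intro frechet_derivative_add_smooth[of UNIV] smooth_on_directional assms open_UNIV UNIV_I)

lemma hessian_cmult:
  assumes "smooth_on UNIV f"
  shows "hessian (\<lambda>x. c * f x) z h k = c * hessian f z h k"
  unfolding hessian_def frechet_derivative_cmult_smooth[OF assms UNIV_I]
  by (intro frechet_derivative_cmult_smooth[of UNIV] smooth_on_directional assms open_UNIV UNIV_I)

lemma hessian_const: "hessian (\<lambda>x. c) z h k = 0"
  by (simp add: hessian_def)

lemma hessian_eqI:
  assumes "open U" "x \<in> U" "\<And>y. y \<in> U \<Longrightarrow> f y = g y" "smooth_on U f"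
  shows "hessian f x h k = hessian g x h k"
proof -
  have g: "smooth_on U g"
    using assms smooth_on_cong by blast
  have *: "frechet_derivative f (at y) h = frechet_derivative g (at y) h" if "y \<in> U" for y
    by (rule frechet_derivative_transform_within_open[OF differentiableI assms(1) that assms(3),
          THEN fun_cong]) (rule smooth_on_has_derivative[OF assms(4) that])
  show ?thesis
    unfolding hessian_def
    by (rule frechet_derivative_transform_within_open[OF differentiableI assms(1,2) *, THEN fun_cong])
      (rule smooth_on_has_derivative[OF smooth_on_directional[OF assms(1,4)] assms(2)])
qed

text \<open>Reduces joint continuity in the base point and the directions to continuity in the base
  point for finitely many fixed directions, and gives homogeneity in the directions.\<close>

lemma hessian_Basis:
  assumes "open U" "smooth_on U f" "x \<in> U"
  shows "hessian f x h k = (\<Sum>b\<in>Basis. \<Sum>b'\<in>Basis. (h \<bullet> b') * (k \<bullet> b) * hessian f x b' b)"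
proof -
  have 1: "frechet_derivative f (at y) h = (\<Sum>b'\<in>Basis. (h \<bullet> b') * frechet_derivative f (at y) b')"
    if "y \<in> U" for y
    by (rule frechet_derivative_Basis[OF differentiableI[OF smooth_on_has_derivative[OF assms(2) that]]])
  have 2: "hessian f x h b = (\<Sum>b'\<in>Basis. (h \<bullet> b') * hessian f x b' b)" for b
  proof -
    have "((\<lambda>y. \<Sum>b'\<in>Basis. (h \<bullet> b') * frechet_derivative f (at y) b') has_derivative
        (\<lambda>b. \<Sum>b'\<in>Basis. (h \<bullet> b') * hessian f x b' b)) (at x)"
      unfolding hessian_def
      by (intro has_derivative_sum has_derivative_mult_right
          smooth_on_has_derivative[OF smooth_on_directional[OF assms(1,2)] assms(3)])
    from has_derivative_transform_within_open[OF this assms(1,3) 1[symmetric]]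
    have "((\<lambda>y. frechet_derivative f (at y) h) has_derivative
        (\<lambda>b. \<Sum>b'\<in>Basis. (h \<bullet> b') * hessian f x b' b)) (at x)" .
    from frechet_derivative_at[OF this, THEN fun_cong, of b] show ?thesis
      by (simp add: hessian_def)
  qed
  have "hessian f x h k = (\<Sum>b\<in>Basis. (k \<bullet> b) * hessian f x h b)"
    unfolding hessian_def
    by (rule frechet_derivative_Basis[OF differentiableI[OF smooth_on_has_derivative[OF
            smooth_on_directional[OF assms(1,2)] assms(3)]]])
  then show ?thesis
    by (simp add: 2 sum_distrib_left mult.assoc mult.left_commute)
qed

lemma continuous_on_hessian:
  assumes "open U" "smooth_on U f"
  shows "continuous_on U (\<lambda>x. hessian f x h k)"
  unfolding hessian_def
  by (intro smooth_on_imp_continuous_on smooth_on_directional assms)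

lemma hessian_scale:
  assumes "open U" "smooth_on U f" "x \<in> U"
  shows "hessian f x (c *\<^sub>R h) (c *\<^sub>R h) = c\<^sup>2 * hessian f x h h"
  unfolding hessian_Basis[OF assms, of "c *\<^sub>R h"] hessian_Basis[OF assms, of h h]
  by (simp add: sum_distrib_left power2_eq_square mult_ac)

text \<open>The slice at s = 0 is identically zero, so its Hessian in the z directions vanishes.
  Uniform continuity on a compact set of parameters, points and unit directions carries this over to
  small s; far from the origin the function is locally zero.\<close>

lemma hessian_slice_small:
  fixes \<Psi> :: "real \<times> 'a::euclidean_space \<Rightarrow> real"
  assumes "a > 0" "smooth_on ({-a<..<a} \<times> UNIV) \<Psi>" "\<And>z. \<Psi> (0, z) = 0"
    and "\<And>s z. norm z > 3/2 \<Longrightarrow> \<Psi> (s, z) = 0" "\<eta> > 0"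
  obtains s0 where "0 < s0" "s0 \<le> a"
    "\<And>s z h. \<bar>s\<bar> < s0 \<Longrightarrow> \<bar>hessian \<Psi> (s, z) (0, h) (0, h)\<bar> \<le> \<eta> * (norm h)\<^sup>2"
proof -
  let ?U = "{-a<..<a} \<times> (UNIV :: 'a set)"
  have U: "open ?U" by (intro open_Times open_greaterThanLessThan open_UNIV)
  define G where "G = (\<lambda>x :: real \<times> 'a \<times> 'a.
    hessian \<Psi> (fst x, fst (snd x)) (0, snd (snd x)) (0, snd (snd x)))"
  \<comment> \<open>Half the parameter interval keeps the base points in the domain. Radius 2
    exceeds 3/2, so \<open>\<Psi>\<close> vanishes near every point with
    \<open>norm z > 2\<close>.\<close>
  define T where "T = {-a/2..a/2} \<times> cball (0::'a) 2 \<times> sphere (0::'a) 1"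
  have T: "compact T" unfolding T_def by (intro compact_Times compact_Icc compact_cball compact_sphere)
  have TU: "(fst x, fst (snd x)) \<in> ?U" if "x \<in> T" for x
    using that assms(1) by (auto simp: T_def)
  have "continuous_on T (\<lambda>x. \<Sum>b\<in>Basis. \<Sum>b'\<in>Basis. ((0, snd (snd x)) \<bullet> b') * ((0, snd (snd x)) \<bullet> b) *
      hessian \<Psi> (fst x, fst (snd x)) b' b)"
    by (intro continuous_intros continuous_on_compose2[OF continuous_on_hessian[OF U assms(2)]])
      (use TU in blast)
  then have cont: "continuous_on T G"
    by (rule continuous_on_eq) (unfold G_def, rule hessian_Basis[OF U assms(2) TU, symmetric])
  obtain d where d: "d > 0" "\<And>x x'. x \<in> T \<Longrightarrow> x' \<in> T \<Longrightarrow> dist x' x < d \<Longrightarrow> dist (G x') (G x) < \<eta>"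
    using compact_uniformly_continuous[OF cont T] assms(5)
    unfolding uniformly_continuous_on_def by metis
  have G0: "G (0, z, h) = 0" for z h
  proof -
    have L: "bounded_linear (\<lambda>x::'a. (0::real, x))"
      by (intro bounded_linear_Pair bounded_linear_zero bounded_linear_ident)
    have "G (0, z, h) = hessian (\<lambda>x. \<Psi> (0 + (0, x))) z h h"
      using hessian_affine[OF assms(2) U L, of 0 z h h] assms(1) by (simp add: G_def)
    then show ?thesis by (simp add: assms(3) hessian_const)
  qed
  show thesis
  proof
    show "min d (a/2) > 0" "min d (a/2) \<le> a" using d(1) assms(1) by auto
  next
    fix s z and h :: 'a assume s: "\<bar>s\<bar> < min d (a/2)"
    then have sU: "(s, z) \<in> ?U" by auto
    show "\<bar>hessian \<Psi> (s, z) (0, h) (0, h)\<bar> \<le> \<eta> * (norm h)\<^sup>2"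
    proof (cases "norm z \<le> 2 \<and> h \<noteq> 0")
      case True
      define e where "e = h /\<^sub>R norm h"
      have e: "norm e = 1" "(0::real, h) = norm h *\<^sub>R (0, e)"
        using True by (simp_all add: e_def)
      have "(s, z, e) \<in> T" "(0, z, e) \<in> T"
        using s True e(1) by (auto simp: T_def)
      moreover have "dist (s, z, e) (0, z, e) < d"
        using s by (simp add: dist_Pair_Pair)
      ultimately have "dist (G (s, z, e)) (G (0, z, e)) < \<eta>"
        by (intro d(2))
      then have "\<bar>G (s, z, e)\<bar> < \<eta>" by (simp add: G0)
      moreover have "hessian \<Psi> (s, z) (0, h) (0, h) = (norm h)\<^sup>2 * G (s, z, e)"
        unfolding e(2) hessian_scale[OF U assms(2) sU] by (simp add: G_def)
      ultimately show ?thesis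
        by (simp add: abs_mult mult.commute[of \<eta>] mult_left_mono less_imp_le)
    next
      case False
      then consider "norm z > 2" | "h = 0" by fastforce
      then have "hessian \<Psi> (s, z) (0, h) (0, h) = 0"
      proof cases
        case 1
        let ?V = "(UNIV :: real set) \<times> - cball (0::'a) (3/2)"
        have "hessian (\<lambda>_. 0) (s, z) (0, h) (0, h) = hessian \<Psi> (s, z) (0, h) (0, h)"
          using 1 assms(4)
          by (intro hessian_eqI[of ?V] smooth_on_const open_Times open_UNIV) (auto simp: open_Compl)
        then show ?thesis by (simp add: hessian_const)
      next
        case 2
        then show ?thesis
          using hessian_scale[OF U assms(2) sU, of 0 "(0, h)"] by (simp add: zero_prod_def)
      qed
      then show ?thesis using assms(5) by simp
    qed
  qed
qed

section \<open>Level sets of strongly convex functions\<close>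

text \<open>On the segment from x to x + h, subtracting m/2 t^2 |h|^2 leaves a function of t with
  nonnegative second derivative, which lies above its tangent at t = 0.\<close>

lemma strongly_convex_lower_bound:
  fixes C :: "'a::euclidean_space \<Rightarrow> real"
  assumes "smooth_on UNIV C" "\<And>z h. m * (norm h)\<^sup>2 \<le> hessian C z h h"
  shows "C x + frechet_derivative C (at x) h + m / 2 * (norm h)\<^sup>2 \<le> C (x + h)"
proof -
  let ?D = "\<lambda>t. frechet_derivative C (at (x + t *\<^sub>R h)) h"
  have line: "((\<lambda>t. f (x + t *\<^sub>R h)) has_real_derivative frechet_derivative f (at (x + t *\<^sub>R h)) h) (at t)"
    if "smooth_on UNIV f" for f :: "'a \<Rightarrow> real" and t
  proof -
    have "((\<lambda>t. x + t *\<^sub>R h) has_derivative (\<lambda>t. t *\<^sub>R h)) (at t)"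
      by (auto intro!: derivative_eq_intros)
    from has_derivative_compose[OF this smooth_on_has_derivative[OF that UNIV_I]]
    have "((\<lambda>t. f (x + t *\<^sub>R h)) has_derivative
        (\<lambda>s. frechet_derivative f (at (x + t *\<^sub>R h)) (s *\<^sub>R h))) (at t)" .
    moreover have "linear (frechet_derivative f (at (x + t *\<^sub>R h)))"
      using smooth_on_has_derivative[OF that UNIV_I] has_derivative_linear by blast
    ultimately show ?thesis
      by (simp add: has_field_derivative_def linear_scale mult.commute[of _ "frechet_derivative f _ h"])
  qed
  have "(?D 0 - m * 0 * (norm h)\<^sup>2) * (1 - 0)
      \<le> (C (x + 1 *\<^sub>R h) - m / 2 * 1\<^sup>2 * (norm h)\<^sup>2) - (C (x + 0 *\<^sub>R h) - m / 2 * 0\<^sup>2 * (norm h)\<^sup>2)"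
  proof (rule f''_imp_f'[of UNIV "\<lambda>t. C (x + t *\<^sub>R h) - m / 2 * t\<^sup>2 * (norm h)\<^sup>2"
        "\<lambda>t. ?D t - m * t * (norm h)\<^sup>2"
        "\<lambda>t. hessian C (x + t *\<^sub>R h) h h - m * (norm h)\<^sup>2"])
    show "((\<lambda>t. C (x + t *\<^sub>R h) - m / 2 * t\<^sup>2 * (norm h)\<^sup>2) has_real_derivative ?D t - m * t * (norm h)\<^sup>2) (at t)" for t
      by (rule derivative_eq_intros line[OF assms(1)] refl | simp)+
    show "((\<lambda>t. ?D t - m * t * (norm h)\<^sup>2) has_real_derivative hessian C (x + t *\<^sub>R h) h h - m * (norm h)\<^sup>2) (at t)" for t
      unfolding hessian_def
      by (rule derivative_eq_intros line[OF smooth_on_directional[OF open_UNIV assms(1)]] refl | simp)+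
  qed (use assms(2) in auto)
  then show ?thesis by simp
qed

text \<open>The tangent inequalities at the intermediate point, averaged with weights 1 - t and t,
  have cancelling linear terms.\<close>

lemma convex_on_subgradientI:
  fixes C :: "'a::real_normed_vector \<Rightarrow> real"
  assumes "\<And>x. linear (D x)" "\<And>x h. C x + D x h \<le> C (x + h)"
  shows "convex_on UNIV C"
proof (rule convex_onI)
  fix t :: real and x y :: 'a
  assume t: "t > 0" "t < 1"
  define z where "z = (1 - t) *\<^sub>R x + t *\<^sub>R y"
  interpret linear "D z" by (rule assms(1))
  have "(1 - t) * (C z + D z (x - z)) + t * (C z + D z (y - z)) \<le> (1 - t) * C x + t * C y"
    using assms(2)[of z "x - z"] assms(2)[of z "y - z"] t
    by (intro add_mono mult_left_mono) auto
  moreover have "(1 - t) * D z (x - z) + t * D z (y - z) = D z ((1 - t) *\<^sub>R (x - z) + t *\<^sub>R (y - z))"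
    by (simp add: add scaleR)
  moreover have "(1 - t) *\<^sub>R (x - z) + t *\<^sub>R (y - z) = 0"
    unfolding z_def by (simp add: algebra_simps)
  ultimately show "C ((1 - t) *\<^sub>R x + t *\<^sub>R y) \<le> (1 - t) * C x + t * C y"
    by (simp add: z_def[symmetric] zero algebra_simps)
qed simp

context
  fixes C :: "'a::euclidean_space \<Rightarrow> real" and m :: real
  assumes smooth: "smooth_on UNIV C" and m: "m > 0"
    and hess: "\<And>z h. m * (norm h)\<^sup>2 \<le> hessian C z h h"
    and even: "\<And>z. C (- z) = C z" and C0: "C 0 < 1"
begin

text \<open>The lower bound at the origin, applied to z and -z, has linear terms of opposite sign;
  evenness of \<open>C\<close> lets their sum cancel them.\<close>

lemma level_set_norm_bound: "C 0 + m / 2 * (norm z)\<^sup>2 \<le> C z"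
proof -
  have "linear (frechet_derivative C (at 0))"
    using smooth_on_has_derivative[OF smooth UNIV_I] has_derivative_linear by blast
  then show ?thesis
    using strongly_convex_lower_bound[OF smooth hess, of 0 z]
      strongly_convex_lower_bound[OF smooth hess, of 0 "-z"]
    by (simp add: even linear_neg)
qed

text \<open>Comparing \<open>x\<close> with the origin bounds the radial derivative below by C x - C
  0 plus a positive term. Hence the origin is the only critical point.\<close>

lemma radial_derivative_pos:
  assumes "x \<noteq> 0"
  shows "frechet_derivative C (at x) x > 0"
proof -
  have "linear (frechet_derivative C (at x))"
    using smooth_on_has_derivative[OF smooth UNIV_I] has_derivative_linear by blast
  then have "C x - frechet_derivative C (at x) x + m / 2 * (norm x)\<^sup>2 \<le> C 0"
    using strongly_convex_lower_bound[OF smooth hess, of x "-x"] by (simp add: linear_neg)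
  moreover have "0 < m / 2 * (norm x)\<^sup>2" using m assms by simp
  ultimately show ?thesis using level_set_norm_bound[of x] by linarith
qed

lemma convex_on_C: "convex_on UNIV C"
proof (rule convex_on_subgradientI)
  show "linear (frechet_derivative C (at x))" for x
    using smooth_on_has_derivative[OF smooth UNIV_I] has_derivative_linear by blast
  show "C x + frechet_derivative C (at x) h \<le> C (x + h)" for x h
  proof -
    have "0 \<le> m / 2 * (norm h)\<^sup>2" using m by simp
    then show ?thesis using strongly_convex_lower_bound[OF smooth hess, of x h] by linarith
  qed
qed

lemma bounded_sublevel: "bounded {z. C z \<le> 1}"
proof -
  have "norm z \<le> sqrt (2 / m * (1 - C 0))" if "C z \<le> 1" for z
  proof -
    have "m / 2 * (norm z)\<^sup>2 \<le> 1 - C 0" using level_set_norm_bound[of z] that by linarith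
    then have "(norm z)\<^sup>2 \<le> 2 / m * (1 - C 0)" using m by (simp add: field_simps)
    then show ?thesis by (rule real_le_rsqrt)
  qed
  then show ?thesis by (auto simp: bounded_iff)
qed

lemma closed_level_sets: "closed {z. C z \<le> 1}" "closed (C -` {1})" "open {z. C z < 1}"
  using smooth_on_imp_continuous_on[OF smooth]
  by (auto intro: closed_Collect_le open_Collect_less continuous_closed_vimage simp: continuous_on_eq_continuous_at)

text \<open>The complement of the origin serves as the neighbourhood of every point: it contains the
  level set because \<open>C 0 < 1\<close>, and \<open>C\<close> has no critical point there. The
  constant is m/2 because positive definiteness is strict.\<close>

lemma bounds_strongly_convex_domain_level: "bounds_strongly_convex_domain (C -` {1})"
proof -
  have "bounded (C -` {1})"
    by (rule bounded_subset[OF bounded_sublevel]) auto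
  then have "compact (C -` {1})"
    using closed_level_sets by (simp add: compact_eq_bounded_closed)
  moreover have "smooth_hypersurface (C -` {1})"
    unfolding smooth_hypersurface_def
  proof
    fix x assume x: "x \<in> C -` {1}"
    have C1: "smooth_on UNIV (\<lambda>x. C x + (- 1))"
      by (intro smooth_on_intros smooth open_UNIV)
    have "frechet_derivative (\<lambda>x. C x + (- 1)) (at y) \<noteq> (\<lambda>_. 0)" if "y \<noteq> 0" for y
      using radial_derivative_pos[OF that]
        frechet_derivative_add_smooth[OF smooth smooth_on_const UNIV_I, of "-1" y y] by auto
    moreover have "smooth_on (- {0}) (\<lambda>x. C x + (- 1))"
      by (rule smooth_on_subset[OF C1 subset_UNIV])
    ultimately show "\<exists>U f. open U \<and> x \<in> U \<and> smooth_on U f \<and>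
        (\<forall>y\<in>U. frechet_derivative f (at y) \<noteq> (\<lambda>_. 0)) \<and> C -` {1} \<inter> U = {y \<in> U. f y = 0}"
      using x C0 by (intro exI[of _ "- {0}"] exI[of _ "\<lambda>x. C x + (- 1)"])
        (auto simp del: add_uminus_conv_diff)
  qed
  moreover have "positive_definite (\<lambda>h k. hessian C z h k - m / 2 * (h \<bullet> k))" for z
    unfolding positive_definite_def
  proof (intro allI impI)
    fix h :: 'a assume "h \<noteq> 0"
    then have "m / 2 * (norm h)\<^sup>2 < m * (norm h)\<^sup>2" using m by simp
    with hess[of h z] show "0 < hessian C z h h - m / 2 * (h \<bullet> h)"
      by (simp add: power2_norm_eq_inner)
  qed
  ultimately have *: "compact (C -` {1})" "smooth_hypersurface (C -` {1})"
    "\<And>z. positive_definite (\<lambda>h k. hessian C z h k - m / 2 * (h \<bullet> k))" .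
  show ?thesis
    unfolding bounds_strongly_convex_domain_def
  proof (intro conjI *(1,2) exI[of _ "m / 2"] half_gt_zero m)
    show "\<exists>C'. smooth_on UNIV C' \<and> convex_on UNIV C' \<and> C -` {1} = C' -` {1} \<and>
        (\<forall>z. positive_definite (\<lambda>h k. hessian C' z h k - m / 2 * (h \<bullet> k)))"
      by (intro exI[of _ C] conjI smooth convex_on_C refl allI *(3))
  qed
qed

text \<open>The level set is the boundary of a bounded convex body with interior, hence homeomorphic
  to the unit sphere.\<close>

lemma connected_level:
  assumes "DIM('a) \<ge> 2"
  shows "connected (C -` {1})"
proof -
  let ?B = "{z. C z \<le> 1}"
  have conv: "convex ?B"
  proof (rule convexI)
    fix x y :: 'a and u v :: real
    assume *: "x \<in> ?B" "y \<in> ?B" "0 \<le> u" "0 \<le> v" "u + v = 1"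
    then have "C (u *\<^sub>R x + v *\<^sub>R y) \<le> max (C x) (C y)"
      by (intro convex_lower[OF convex_on_C UNIV_I UNIV_I])
    with *(1,2) show "u *\<^sub>R x + v *\<^sub>R y \<in> ?B" by (simp add: max_def split: if_splits)
  qed
  have sub: "{z. C z < 1} \<subseteq> interior ?B"
    using closed_level_sets(3) by (intro interior_maximal) auto
  \<comment> \<open>At an interior point of level 1, a small step outward would stay in the sublevel
    set although \<open>C\<close> increases radially. The step t x has length e/2.\<close>
  have "C x < 1" if xi: "x \<in> interior ?B" for x
  proof (rule ccontr)
    assume "\<not> C x < 1"
    then have x: "C x = 1" "x \<noteq> 0"
      using that interior_subset C0 by fastforce+
    obtain e where e: "e > 0" "ball x e \<subseteq> ?B"
      using mem_interior[THEN iffD1, OF xi] by (elim exE conjE)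
    define t where "t = e / 2 / norm x"
    have t: "t > 0" using e x by (simp add: t_def)
    have "x + t *\<^sub>R x \<in> ball x e"
      using e x by (simp add: t_def dist_norm)
    then have "C (x + t *\<^sub>R x) \<le> 1" using e by blast
    moreover have "frechet_derivative C (at x) (t *\<^sub>R x) = t * frechet_derivative C (at x) x"
      using linear_scale[OF has_derivative_linear[OF smooth_on_has_derivative[OF smooth UNIV_I]]]
      by simp
    moreover have "0 \<le> m / 2 * (norm (t *\<^sub>R x))\<^sup>2" using m by simp
    ultimately have "t * frechet_derivative C (at x) x \<le> 0"
      using strongly_convex_lower_bound[OF smooth hess, of x "t *\<^sub>R x"] x by linarith
    then show False
      using mult_pos_pos[OF t radial_derivative_pos[OF x(2)]] by linarith
  qed
  then have int: "interior ?B = {z. C z < 1}" using sub by blast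
  then have fr: "frontier ?B = C -` {1}"
    using closed_level_sets(1) by (auto simp: frontier_def)
  have ne: "interior ?B \<noteq> {}" using C0 int by auto
  have "rel_frontier ?B homeomorphic rel_frontier (cball (0::'a) 1)"
    by (rule homeomorphic_rel_frontiers_convex_bounded_sets[OF conv bounded_sublevel])
      (use ne in \<open>auto simp: aff_dim_nonempty_interior\<close>)
  then have "C -` {1} homeomorphic sphere (0::'a) 1"
    by (simp add: rel_frontier_nonempty_interior[OF ne] rel_frontier_nonempty_interior fr)
  then show ?thesis
    using homeomorphic_connectedness connected_sphere[OF assms] by blast
qed

end

section \<open>Extension of the regularized Hamiltonian\<close>

text \<open>The quadratic Taylor part of \<open>K\<close> at the origin: there the sun term
  contributes -\<mu> |v|^2, whence the coefficient c - \<mu>.\<close>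

definition K_quadratic :: "real \<Rightarrow> real \<Rightarrow> complex \<times> complex \<Rightarrow> real" where
  "K_quadratic \<mu> c = (\<lambda>(v, u). (cmod u)\<^sup>2 / 2 - \<mu> * Im (u * v) + (c - \<mu>) * (cmod v)\<^sup>2)"

text \<open>The non-quadratic part of \<open>K\<close> is \<open>quartic_part - \<mu> * potential_part\<close>. Both parts are
  rescaled by \<open>z \<mapsto> z / r\<close>, \<open>s = r\<^sup>2\<close>, and multiplied by a bump function that is 1 for
  \<open>norm z \<le> 1\<close> and 0 for \<open>(norm z)\<^sup>2 \<ge> 2\<close>. The scale \<open>s\<close> is a variable so that the Hessians are jointly
  continuous in \<open>(s, z)\<close> and vanish at \<open>s = 0\<close>, hence are uniformly small for small \<open>s\<close>.\<close>

definition quartic_part :: "real \<times> complex \<times> complex \<Rightarrow> real" where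
  "quartic_part = (\<lambda>(s, v, u).
     cutoff ((norm (v, u))\<^sup>2) * (s * (2 * (cmod v)\<^sup>2 * (u \<bullet> (\<i> * v)))))"

definition potential_part :: "real \<times> complex \<times> complex \<Rightarrow> real" where
  "potential_part = (\<lambda>(s, v, u).
     cutoff ((norm (v, u))\<^sup>2) * ((cmod v)\<^sup>2 * (1 / cmod (2 * (of_real s * v\<^sup>2) - 1) - 1)))"

text \<open>Adding 1 moves the zero level of \<open>K\<close> to level 1. The factor
  \<open>r\<^sup>2\<close> undoes the rescaling of both parts.\<close>

definition K_extension :: "real \<Rightarrow> real \<Rightarrow> real \<Rightarrow> complex \<times> complex \<Rightarrow> real" where
  "K_extension \<mu> c r z = 1 - (1 - \<mu>) / 2 + K_quadratic \<mu> c z +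
     r\<^sup>2 * (quartic_part (r\<^sup>2, z /\<^sub>R r) - \<mu> * potential_part (r\<^sup>2, z /\<^sub>R r))"

lemma norm_prod_power2: "(norm (a, b))\<^sup>2 = (norm a)\<^sup>2 + (norm b)\<^sup>2"
  by (simp add: norm_Pair)

lemma K_extension_eq_K:
  assumes "r > 0" "norm z \<le> r"
  shows "K_extension \<mu> c r z = 1 + K \<mu> c z"
proof -
  obtain v u where z: "z = (v, u)" by (cases z)
  have "norm (z /\<^sub>R r) \<le> 1" using assms by (simp add: field_simps)
  then have cut: "cutoff ((norm (z /\<^sub>R r))\<^sup>2) = 1"
    by (intro cutoff_eq_1) (simp add: abs_square_le_1)
  have v: "of_real (r\<^sup>2) * (v /\<^sub>R r)\<^sup>2 = v\<^sup>2"
    using assms(1) by (simp add: scaleR_conv_of_real power_mult_distrib power_inverse field_simps)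
  have "r\<^sup>2 * quartic_part (r\<^sup>2, z /\<^sub>R r) = 2 * (cmod v)\<^sup>2 * (u \<bullet> (\<i> * v))"
    using cut assms(1) unfolding quartic_part_def z
    by (simp add: power_mult_distrib power_inverse field_simps power2_eq_square)
  moreover have "r\<^sup>2 * potential_part (r\<^sup>2, z /\<^sub>R r) = (cmod v)\<^sup>2 * (1 / cmod (2 * v\<^sup>2 - 1) - 1)"
    using cut assms(1) v unfolding potential_part_def z
    by (simp add: power_mult_distrib power_inverse)
  ultimately have "K_extension \<mu> c r z = 1 - (1 - \<mu>) / 2 + K_quadratic \<mu> c z +
      (2 * (cmod v)\<^sup>2 * (u \<bullet> (\<i> * v)) - \<mu> * ((cmod v)\<^sup>2 * (1 / cmod (2 * v\<^sup>2 - 1) - 1)))"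
    unfolding K_extension_def right_diff_distrib[of "r\<^sup>2"] mult.left_commute[of "r\<^sup>2" \<mu>] by simp
  then show ?thesis
    by (simp add: K_def K_quadratic_def z algebra_simps)
qed

text \<open>Reflects the 2:1 nature of the Levi-Civita map, under which (v, u) and (-v, -u) have the
  same image. It supplies the evenness assumed of \<open>C\<close> above.\<close>

lemma K_extension_minus: "K_extension \<mu> c r (- z) = K_extension \<mu> c r z"
proof -
  obtain v u where z: "z = (v, u)" by (cases z)
  have n: "norm (- a, - b) = norm (a, b)" for a b :: complex
    by (simp add: norm_Pair)
  have "K_quadratic \<mu> c (- z) = K_quadratic \<mu> c z"
    by (simp add: K_quadratic_def z)
  moreover have "quartic_part (s, - w) = quartic_part (s, w)" for s w
    by (cases w) (simp add: quartic_part_def n)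
  moreover have "potential_part (s, - w) = potential_part (s, w)" for s w
    by (cases w) (simp add: potential_part_def n)
  ultimately show ?thesis
    by (simp add: K_extension_def)
qed

lemma K_extension_0: "K_extension \<mu> c r 0 = 1 - (1 - \<mu>) / 2"
  by (simp add: K_extension_def K_quadratic_def quartic_part_def potential_part_def zero_prod_def)

section \<open>The quadratic part: Hessian and positive definiteness\<close>

lemma K_quadratic_Re_Im:
  "K_quadratic \<mu> c z = (1 / 2) * (Re (snd z) ^ 2 + Im (snd z) ^ 2)
    - \<mu> * (Re (snd z) * Im (fst z) + Im (snd z) * Re (fst z)) + (c - \<mu>) * (Re (fst z) ^ 2 + Im (fst z) ^ 2)"
  by (simp add: K_quadratic_def case_prod_unfold cmod_power2)

lemma smooth_on_K_quadratic: "smooth_on UNIV (K_quadratic \<mu> c)"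
proof -
  have lin: "smooth_on UNIV (\<lambda>z::complex \<times> complex. Re (fst z))" "smooth_on UNIV (\<lambda>z::complex \<times> complex. Im (fst z))"
      "smooth_on UNIV (\<lambda>z::complex \<times> complex. Re (snd z))" "smooth_on UNIV (\<lambda>z::complex \<times> complex. Im (snd z))"
    by (intro smooth_on_bounded_linear open_UNIV bounded_linear_compose[OF bounded_linear_Re]
        bounded_linear_compose[OF bounded_linear_Im] bounded_linear_fst bounded_linear_snd)+
  show ?thesis
    unfolding K_quadratic_Re_Im[abs_def] by (intro smooth_on_intros lin open_UNIV)
qed

lemma hessian_K_quadratic: "hessian (K_quadratic \<mu> c) z h h = 2 * K_quadratic \<mu> c h"
proof -
  \<comment> \<open>The polar form of the quadratic form: the first derivative at \<open>w\<close>
    in direction \<open>h\<close>, and itself affine along lines in direction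
    \<open>h\<close>.\<close>
  define B where "B w = K_quadratic \<mu> c (w + h) - K_quadratic \<mu> c w - K_quadratic \<mu> c h" for w
  have line: "K_quadratic \<mu> c (w + t *\<^sub>R h) = K_quadratic \<mu> c w + t * B w + t\<^sup>2 * K_quadratic \<mu> c h" for w t
    unfolding B_def K_quadratic_Re_Im by (simp add: power2_eq_square field_simps)
  have dir: "(f has_derivative frechet_derivative f (at w)) (at w) \<Longrightarrow>
      ((\<lambda>t. f (w + t *\<^sub>R h)) has_real_derivative D) (at 0) \<Longrightarrow> frechet_derivative f (at w) h = D"
    for f :: "complex \<times> complex \<Rightarrow> real" and w D
  proof -
    assume f: "(f has_derivative frechet_derivative f (at w)) (at w)"
      and D: "((\<lambda>t. f (w + t *\<^sub>R h)) has_real_derivative D) (at 0)"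
    have "((\<lambda>t. w + t *\<^sub>R h) has_derivative (\<lambda>t. t *\<^sub>R h)) (at 0)"
      by (auto intro!: derivative_eq_intros)
    moreover have "(f has_derivative frechet_derivative f (at w)) (at (w + 0 *\<^sub>R h))"
      using f by simp
    ultimately have "((\<lambda>t. f (w + t *\<^sub>R h)) has_derivative (\<lambda>t. frechet_derivative f (at w) (t *\<^sub>R h))) (at 0)"
      by (rule has_derivative_compose)
    from has_derivative_unique[OF this D[unfolded has_field_derivative_def]]
    show "frechet_derivative f (at w) h = D"
      by (auto dest: fun_cong[of _ _ 1])
  qed
  have first: "frechet_derivative (K_quadratic \<mu> c) (at w) h = B w" for w
  proof (rule dir[OF smooth_on_has_derivative[OF smooth_on_K_quadratic UNIV_I]])
    show "((\<lambda>t. K_quadratic \<mu> c (w + t *\<^sub>R h)) has_real_derivative B w) (at 0)"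
      unfolding line by (auto intro!: derivative_eq_intros)
  qed
  have B_line: "B (z + t *\<^sub>R h) = B z + t * (2 * K_quadratic \<mu> c h)" for t
    unfolding B_def K_quadratic_Re_Im by (simp add: power2_eq_square field_simps)
  have "frechet_derivative (\<lambda>w. frechet_derivative (K_quadratic \<mu> c) (at w) h) (at z) h = 2 * K_quadratic \<mu> c h"
  proof (rule dir[OF smooth_on_has_derivative[OF smooth_on_directional[OF open_UNIV smooth_on_K_quadratic] UNIV_I]])
    show "((\<lambda>t. frechet_derivative (K_quadratic \<mu> c) (at (z + t *\<^sub>R h)) h) has_real_derivative 2 * K_quadratic \<mu> c h) (at 0)"
      unfolding first B_line by (auto intro!: derivative_eq_intros)
  qed
  then show ?thesis by (simp add: hessian_def)
qed

text \<open>Bounding \<mu> by 1 leaves the form y^2 - 2xy + (2c - 2)x^2 in x = |v|, y = |u|. Its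
  matrix has determinant 2c - 3 and trace 2c - 1, and determinant over trace is a lower bound for
  the smaller eigenvalue.\<close>

lemma K_quadratic_lower_bound:
  assumes "c > 3 / 2" "0 \<le> \<mu>" "\<mu> \<le> 1"
  shows "(2 * c - 3) / (2 * c - 1) * (norm h)\<^sup>2 \<le> 2 * K_quadratic \<mu> c h"
proof -
  define k where "k = (2 * c - 3) / (2 * c - 1)"
  obtain v u where h: "h = (v, u)" by (cases h)
  define x y where "x = cmod v" and "y = cmod u"
  have k: "k * (2 * c - 1) = 2 * c - 3" "k < 1"
    using assms(1) by (simp_all add: k_def)
  have "\<mu> * Im (u * v) \<le> \<mu> * cmod (u * v)"
    using assms(2) abs_Im_le_cmod[of "u * v"] by (intro mult_left_mono) auto
  also have "\<dots> \<le> 1 * cmod (u * v)"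
    using assms(3) by (intro mult_right_mono) auto
  finally have "\<mu> * Im (u * v) \<le> y * x"
    by (simp add: x_def y_def norm_mult)
  then have "y\<^sup>2 - 2 * (x * y) + (2 * c - 2) * x\<^sup>2 \<le> 2 * K_quadratic \<mu> c h"
    using mult_right_mono[OF assms(3), of "x\<^sup>2"]
    by (simp add: K_quadratic_def h x_def y_def algebra_simps)
  moreover have "(norm h)\<^sup>2 = x\<^sup>2 + y\<^sup>2"
    by (simp add: h norm_prod_power2 x_def y_def)
  moreover have "0 \<le> (1 - k) * y\<^sup>2 - 2 * (x * y) + (2 * c - 2 - k) * x\<^sup>2"
  proof -
    have "(1 - k) * (2 * c - 2 - k) = 1 + k\<^sup>2"
      using k(1) by algebra
    \<comment> \<open>Completing the square in y, after multiplication by the positive number 1 -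
      k.\<close>
    then have "(1 - k) * ((1 - k) * y\<^sup>2 - 2 * (x * y) + (2 * c - 2 - k) * x\<^sup>2) =
        ((1 - k) * y - x)\<^sup>2 + k\<^sup>2 * x\<^sup>2"
      by algebra
    then have "0 \<le> (1 - k) * ((1 - k) * y\<^sup>2 - 2 * (x * y) + (2 * c - 2 - k) * x\<^sup>2)"
      by simp
    then show ?thesis using k(2) by (simp add: zero_le_mult_iff)
  qed
  ultimately show ?thesis
    unfolding k_def[symmetric] by (simp add: algebra_simps)
qed

section \<open>Smoothness and Hessian of the extension\<close>

lemma smooth_on_coordinates:
  "smooth_on UNIV (\<lambda>x::real \<times> complex \<times> complex. fst x)"
  "smooth_on UNIV (\<lambda>x::real \<times> complex \<times> complex. Re (fst (snd x)))"
  "smooth_on UNIV (\<lambda>x::real \<times> complex \<times> complex. Im (fst (snd x)))"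
  "smooth_on UNIV (\<lambda>x::real \<times> complex \<times> complex. Re (snd (snd x)))"
  "smooth_on UNIV (\<lambda>x::real \<times> complex \<times> complex. Im (snd (snd x)))"
  by (intro smooth_on_bounded_linear open_UNIV bounded_linear_compose[OF bounded_linear_Re]
      bounded_linear_compose[OF bounded_linear_Im] bounded_linear_fst bounded_linear_snd
      bounded_linear_compose[OF bounded_linear_fst] bounded_linear_compose[OF bounded_linear_snd])+

lemma smooth_on_norm_power2_snd:
  "smooth_on UNIV (\<lambda>x::real \<times> complex \<times> complex. (norm (snd x))\<^sup>2)"
proof -
  have "(norm (snd x))\<^sup>2 = Re (fst (snd x)) ^ 2 + Im (fst (snd x)) ^ 2 + (Re (snd (snd x)) ^ 2 + Im (snd (snd x)) ^ 2)"
    for x :: "real \<times> complex \<times> complex"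
    by (cases x) (simp add: norm_prod_power2 cmod_power2)
  then show ?thesis
    by (simp only:) (intro smooth_on_intros smooth_on_coordinates open_UNIV)
qed

lemma smooth_on_cutoff_norm:
  "smooth_on UNIV (\<lambda>x::real \<times> complex \<times> complex. cutoff ((norm (snd x))\<^sup>2))"
  by (rule smooth_on_compose[OF smooth_on_cutoff smooth_on_norm_power2_snd]) auto

lemma smooth_on_quartic_part: "smooth_on UNIV quartic_part"
proof -
  have eq: "quartic_part = (\<lambda>x. cutoff ((norm (snd x))\<^sup>2) * (fst x *
      (2 * (Re (fst (snd x)) ^ 2 + Im (fst (snd x)) ^ 2) *
        (Im (snd (snd x)) * Re (fst (snd x)) - Re (snd (snd x)) * Im (fst (snd x))))))"
    by (rule ext) (simp add: quartic_part_def case_prod_unfold cmod_power2 inner_complex_def)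
  show ?thesis
    by (subst eq) (intro smooth_on_intros smooth_on_coordinates smooth_on_cutoff_norm open_UNIV)
qed

text \<open>For |s| < 1/8 and squared norm below 3, |2 s v^2| is at most 3/4, so the singularity is
  avoided. For squared norm above 2 the cutoff vanishes. The two open regions overlap and cover
  everything.\<close>

lemma smooth_on_potential_part: "smooth_on ({-(1/8)<..<1/8} \<times> UNIV) potential_part"
proof -
  let ?U = "{-(1/8)<..<1/8::real} \<times> (UNIV :: (complex \<times> complex) set)"
  let ?N = "\<lambda>x::real \<times> complex \<times> complex. (norm (snd x))\<^sup>2"
  \<comment> \<open>The squared modulus of 2 s v^2 - 1 in real coordinates.\<close>
  let ?D = "\<lambda>x::real \<times> complex \<times> complex.
    (2 * (fst x * (Re (fst (snd x)) ^ 2 - Im (fst (snd x)) ^ 2)) - 1) ^ 2 +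
    (4 * (fst x * (Re (fst (snd x)) * Im (fst (snd x))))) ^ 2"
  let ?V = "?U \<inter> {x. ?N x < 3}" and ?W = "{x. ?N x > 2}"
  have N: "continuous_on UNIV ?N"
    by (rule smooth_on_imp_continuous_on[OF smooth_on_norm_power2_snd])
  have V: "open ?V"
    by (intro open_Int open_Times open_greaterThanLessThan open_UNIV open_Collect_less continuous_on_const N)
  have W: "open ?W"
    by (intro open_Collect_less continuous_on_const N)
  have D: "cmod (2 * (of_real (fst x) * fst (snd x) ^ 2) - 1) = sqrt (?D x)" for x :: "real \<times> complex \<times> complex"
    by (simp add: cmod_def power2_eq_square right_diff_distrib mult_ac)
  have pos: "?D x > 0" if "x \<in> ?V" for x
  proof -
    have "(cmod (fst (snd x)))\<^sup>2 \<le> ?N x"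
      by (cases x) (simp add: norm_prod_power2)
    moreover have "?N x < 3" using that by simp
    ultimately have v: "(cmod (fst (snd x)))\<^sup>2 < 3" by linarith
    have "cmod (2 * (of_real (fst x) * fst (snd x) ^ 2)) = 2 * (\<bar>fst x\<bar> * (cmod (fst (snd x)))\<^sup>2)"
      by (simp add: norm_mult norm_power)
    also have "\<bar>fst x\<bar> * (cmod (fst (snd x)))\<^sup>2 \<le> 1 / 8 * 3"
      using that v by (intro mult_mono) auto
    finally have "cmod (2 * (of_real (fst x) * fst (snd x) ^ 2)) < cmod 1" by simp
    then have "2 * (of_real (fst x) * fst (snd x) ^ 2) \<noteq> 1" by (metis less_irrefl)
    then have "cmod (2 * (of_real (fst x) * fst (snd x) ^ 2) - 1) > 0" by simp
    then show ?thesis unfolding D by simp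
  qed
  have Ds: "smooth_on ?V ?D"
    by (rule smooth_on_subset[OF _ subset_UNIV]) (intro smooth_on_intros smooth_on_coordinates open_UNIV)
  have "smooth_on ?V (\<lambda>x. ?D x powr (- (1 / 2)))"
    by (rule smooth_on_compose[OF smooth_on_powr Ds V open_greaterThan]) (use pos in simp)
  then have "smooth_on ?V (\<lambda>x. cutoff (?N x) * ((Re (fst (snd x)) ^ 2 + Im (fst (snd x)) ^ 2) * (?D x powr (- (1 / 2)) - 1)))"
    by (intro smooth_on_mult smooth_on_add smooth_on_diff smooth_on_power smooth_on_const V
        smooth_on_subset[OF smooth_on_coordinates(2) subset_UNIV]
        smooth_on_subset[OF smooth_on_coordinates(3) subset_UNIV]
        smooth_on_subset[OF smooth_on_cutoff_norm subset_UNIV])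
  moreover have "cutoff (?N x) * ((Re (fst (snd x)) ^ 2 + Im (fst (snd x)) ^ 2) * (?D x powr (- (1 / 2)) - 1)) = potential_part x"
    if "x \<in> ?V" for x
  proof -
    have "?D x powr (- (1 / 2)) = 1 / sqrt (?D x)"
      using pos[OF that] by (simp only: powr_minus_divide powr_half_sqrt less_imp_le)
    then show ?thesis
      by (simp only: potential_part_def case_prod_unfold D prod.collapse cmod_power2)
  qed
  ultimately have "smooth_on ?V potential_part"
    by (rule smooth_on_cong[OF V, THEN iffD1, rotated])
  moreover have "smooth_on ?W potential_part"
  proof -
    have "potential_part x = 0" if "x \<in> ?W" for x
      using that cutoff_eq_0[of "?N x"] by (simp add: potential_part_def case_prod_unfold)
    then show ?thesis
      by (rule smooth_on_cong[OF W, THEN iffD2, OF _ smooth_on_const])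
  qed
  ultimately have "smooth_on (?V \<union> ?W) potential_part"
    by (rule smooth_on_Un[OF V W])
  then show ?thesis
    by (rule smooth_on_subset) auto
qed

text \<open>The prefactor \<open>r\<^sup>2\<close> cancels the two factors 1/r from the chain rule.
  The Hessians of the parts thus enter unscaled at s = r^2, where they are small for small
  r.\<close>

lemma smooth_on_K_extension:
  assumes "r\<^sup>2 < 1 / 8"
  shows "smooth_on UNIV (K_extension \<mu> c r)"
    and "r \<noteq> 0 \<Longrightarrow> hessian (K_extension \<mu> c r) z h h = 2 * K_quadratic \<mu> c h +
      (hessian quartic_part (r\<^sup>2, z /\<^sub>R r) (0, h) (0, h) - \<mu> * hessian potential_part (r\<^sup>2, z /\<^sub>R r) (0, h) (0, h))"
proof -
  let ?U = "{-(1/8)<..<1/8::real} \<times> (UNIV :: (complex \<times> complex) set)"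
  define L where "L = (\<lambda>x :: complex \<times> complex. (0::real, x /\<^sub>R r))"
  have U: "open ?U" by (intro open_Times open_greaterThanLessThan open_UNIV)
  have L: "bounded_linear L"
    unfolding L_def by (intro bounded_linear_Pair bounded_linear_zero bounded_linear_scaleR_right)
  have AU: "(r\<^sup>2, 0) + L x \<in> ?U" for x
    using assms less_le_trans[of "- (1 / 8)" 0 "r\<^sup>2"] by (simp add: L_def)
  have A: "(r\<^sup>2, 0) + L x = (r\<^sup>2, x /\<^sub>R r)" for x
    by (simp add: L_def)
  have Q: "smooth_on ?U quartic_part"
    by (rule smooth_on_subset[OF smooth_on_quartic_part subset_UNIV])
  have s: "smooth_on UNIV (\<lambda>x. quartic_part ((r\<^sup>2, 0) + L x))" "smooth_on UNIV (\<lambda>x. potential_part ((r\<^sup>2, 0) + L x))"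
    by (rule smooth_on_affine[OF Q U L AU] smooth_on_affine[OF smooth_on_potential_part U L AU])+
  have eq: "K_extension \<mu> c r = (\<lambda>z. (1 - (1 - \<mu>) / 2) + (K_quadratic \<mu> c z +
      (r\<^sup>2 * quartic_part ((r\<^sup>2, 0) + L z) + (- (r\<^sup>2 * \<mu>)) * potential_part ((r\<^sup>2, 0) + L z))))"
    unfolding A by (rule ext) (simp add: K_extension_def algebra_simps)
  show "smooth_on UNIV (K_extension \<mu> c r)"
    unfolding eq by (intro smooth_on_intros s smooth_on_K_quadratic open_UNIV)
  assume r: "r \<noteq> 0"
  have Lh: "L h = inverse r *\<^sub>R (0, h)" by (simp add: L_def)
  have scale: "r\<^sup>2 * hessian f ((r\<^sup>2, 0) + L z) (L h) (L h) = hessian f (r\<^sup>2, z /\<^sub>R r) (0, h) (0, h)"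
    if "smooth_on ?U f" for f
    unfolding Lh hessian_scale[OF U that AU] unfolding A using r by (simp add: power_inverse)
  have "hessian (K_extension \<mu> c r) z h h = 2 * K_quadratic \<mu> c h +
      (r\<^sup>2 * hessian quartic_part ((r\<^sup>2, 0) + L z) (L h) (L h) +
       (- (r\<^sup>2 * \<mu>)) * hessian potential_part ((r\<^sup>2, 0) + L z) (L h) (L h))"
    unfolding eq
    by (subst hessian_add hessian_cmult; (intro smooth_on_intros s smooth_on_K_quadratic open_UNIV)?)+
      (simp only: hessian_const hessian_K_quadratic hessian_affine[OF Q U L AU]
        hessian_affine[OF smooth_on_potential_part U L AU] add_0)
  also have "\<dots> = 2 * K_quadratic \<mu> c h + (hessian quartic_part (r\<^sup>2, z /\<^sub>R r) (0, h) (0, h) -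
      \<mu> * hessian potential_part (r\<^sup>2, z /\<^sub>R r) (0, h) (0, h))"
    unfolding scale[OF Q, symmetric] scale[OF smooth_on_potential_part, symmetric] by simp
  finally show "hessian (K_extension \<mu> c r) z h h = 2 * K_quadratic \<mu> c h +
      (hessian quartic_part (r\<^sup>2, z /\<^sub>R r) (0, h) (0, h) - \<mu> * hessian potential_part (r\<^sup>2, z /\<^sub>R r) (0, h) (0, h))" .
qed

section \<open>Critical values\<close>

lemma H_has_derivative:
  assumes "q \<noteq> 0" "q \<noteq> 1"
  shows "(H \<mu> has_derivative (\<lambda>(dq, dp).
      dp \<bullet> (p + \<i> * (q - of_real \<mu>)) +
      dq \<bullet> (- (\<i> * p) + of_real ((1 - \<mu>) / cmod q ^ 3) * q + of_real (\<mu> / cmod (q - 1) ^ 3) * (q - 1))))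
    (at (q, p))"
proof -
  have norm_inv: "((\<lambda>z::complex \<times> complex. inverse (cmod (fst z - a))) has_derivative
      (\<lambda>h. - (fst h \<bullet> (q - a)) / cmod (q - a) ^ 3)) (at (q, p))" if "q \<noteq> a" for a
  proof -
    have n: "cmod (q - a) \<noteq> 0" using that by simp
    have "((\<lambda>z::complex \<times> complex. fst z - a) has_derivative fst) (at (q, p))"
      by (auto intro!: derivative_eq_intros)
    moreover have "(norm has_derivative (\<lambda>h. h \<bullet> sgn (q - a))) (at (fst (q, p) - a))"
      using has_derivative_norm[of "q - a"] that by simp
    ultimately have "((\<lambda>z::complex \<times> complex. cmod (fst z - a)) has_derivative
        (\<lambda>h. fst h \<bullet> sgn (q - a))) (at (q, p))"
      by (rule has_derivative_compose[where f="\<lambda>z. fst z - a" and g=norm])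
    from Deriv.has_derivative_inverse[OF _ this] n
    have "((\<lambda>z::complex \<times> complex. inverse (cmod (fst z - a))) has_derivative
      (\<lambda>h. - (inverse (cmod (q - a)) * (fst h \<bullet> sgn (q - a)) * inverse (cmod (q - a))))) (at (q, p))"
      by simp
    then show ?thesis
      by (rule has_derivative_eq_rhs)
        (use n in \<open>simp add: fun_eq_iff sgn_div_norm power3_eq_cube divide_inverse\<close>)
  qed
  have H: "H \<mu> = (\<lambda>z. 1 / 2 * (snd z \<bullet> snd z) + snd z \<bullet> (\<i> * fst z) - snd z \<bullet> (\<i> * of_real \<mu>)
     - (1 - \<mu>) * inverse (cmod (fst z - 0)) - \<mu> * inverse (cmod (fst z - 1)))"
    by (rule ext, unfold H_def case_prod_unfold power2_norm_eq_inner, simp only: divide_inverse diff_zero)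
      (simp add: mult.commute)
  have "((\<lambda>z::complex \<times> complex. 1 / 2 * (snd z \<bullet> snd z) + snd z \<bullet> (\<i> * fst z) - snd z \<bullet> (\<i> * of_real \<mu>))
      has_derivative (\<lambda>h. 1 / 2 * (snd (q, p) \<bullet> snd h + snd h \<bullet> snd (q, p)) +
        (snd (q, p) \<bullet> (\<i> * fst h) + snd h \<bullet> (\<i> * fst (q, p))) - snd h \<bullet> (\<i> * of_real \<mu>))) (at (q, p))"
    by (intro has_derivative_diff has_derivative_add has_derivative_mult_right has_derivative_inner
        has_derivative_inner_left has_derivative_snd has_derivative_fst has_derivative_ident)
  from has_derivative_diff[OF has_derivative_diff[OF this
        has_derivative_mult_right[OF norm_inv[OF assms(1)], of "1 - \<mu>"]]
      has_derivative_mult_right[OF norm_inv[OF assms(2)], of \<mu>]]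
  moreover have "1 / 2 * (snd (q, p) \<bullet> dp + dp \<bullet> snd (q, p)) + (snd (q, p) \<bullet> (\<i> * dq) + dp \<bullet> (\<i> * fst (q, p))) -
        dp \<bullet> (\<i> * of_real \<mu>) - (1 - \<mu>) * (- (dq \<bullet> (q - 0)) / cmod (q - 0) ^ 3) -
        \<mu> * (- (dq \<bullet> (q - 1)) / cmod (q - 1) ^ 3) =
      dp \<bullet> (p + \<i> * (q - of_real \<mu>)) +
        dq \<bullet> (- (\<i> * p) + of_real ((1 - \<mu>) / cmod q ^ 3) * q + of_real (\<mu> / cmod (q - 1) ^ 3) * (q - 1))" for dq dp
  proof -
    have "p \<bullet> (\<i> * dq) = dq \<bullet> (- (\<i> * p))"
      by (simp add: inner_complex_def)
    then show ?thesis
      unfolding scaleR_conv_of_real[symmetric] inner_add_right inner_diff_right inner_scaleR_right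
        right_diff_distrib fst_conv snd_conv inner_commute[of p dp] diff_zero
      by (simp add: inner_diff_right right_diff_distrib left_diff_distrib diff_divide_distrib)
  qed
  ultimately show ?thesis
    unfolding H case_prod_unfold by (simp only:)
qed

lemma inner_add_inner_eq_0_iff:
  fixes P Q :: "'a::real_inner"
  shows "(\<forall>x y. y \<bullet> P + x \<bullet> Q = 0) \<longleftrightarrow> P = 0 \<and> Q = 0"
  by (metis add.left_neutral add.right_neutral inner_eq_zero_iff inner_zero_left inner_zero_right)

text \<open>The p-gradient fixes p. The term -ip then equals -(q - \<mu>) = -(1 - \<mu>) q - \<mu>
  (q - 1), which puts the -1 into each of the two real coefficients.\<close>

lemma critical_points_iff:
  "(q, p) \<in> critical_points \<mu> \<longleftrightarrow> q \<noteq> 0 \<and> q \<noteq> 1 \<and> p = - (\<i> * (q - of_real \<mu>)) \<and>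
     of_real (1 - \<mu>) * of_real (1 / cmod q ^ 3 - 1) * q + of_real \<mu> * of_real (1 / cmod (q - 1) ^ 3 - 1) * (q - 1) = 0"
proof (cases "q = 0 \<or> q = 1")
  case False
  let ?P = "p + \<i> * (q - of_real \<mu>)"
  let ?Q = "- (\<i> * p) + of_real ((1 - \<mu>) / cmod q ^ 3) * q + of_real (\<mu> / cmod (q - 1) ^ 3) * (q - 1)"
  have Q: "?Q = of_real (1 - \<mu>) * of_real (1 / cmod q ^ 3 - 1) * q + of_real \<mu> * of_real (1 / cmod (q - 1) ^ 3 - 1) * (q - 1)"
    if "p = - (\<i> * (q - of_real \<mu>))"
  proof -
    have "- (\<i> * p) + of_real ((1 - \<mu>) * a) * q + of_real (\<mu> * b) * (q - 1) =
        of_real (1 - \<mu>) * of_real (a - 1) * q + of_real \<mu> * of_real (b - 1) * (q - 1)" for a b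
      unfolding that by (simp add: algebra_simps)
    from this[of "1 / cmod q ^ 3" "1 / cmod (q - 1) ^ 3"] show ?thesis by simp
  qed
  have D: "(H \<mu> has_derivative (\<lambda>(dq, dp). dp \<bullet> ?P + dq \<bullet> ?Q)) (at (q, p))"
    using False by (intro H_has_derivative) auto
  have "(H \<mu> has_derivative (\<lambda>_. 0)) (at (q, p)) \<longleftrightarrow> (\<forall>dq dp. dp \<bullet> ?P + dq \<bullet> ?Q = 0)"
  proof
    assume "(H \<mu> has_derivative (\<lambda>_. 0)) (at (q, p))"
    then have "(\<lambda>(dq, dp). dp \<bullet> ?P + dq \<bullet> ?Q) = (\<lambda>_. 0)"
      using has_derivative_unique[OF D] by blast
    from fun_cong[OF this] have "(case z of (dq, dp) \<Rightarrow> dp \<bullet> ?P + dq \<bullet> ?Q) = 0" for z .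
    from this[of "(_, _)"] show "\<forall>dq dp. dp \<bullet> ?P + dq \<bullet> ?Q = 0"
      unfolding prod.case by (intro allI)
  next
    assume "\<forall>dq dp. dp \<bullet> ?P + dq \<bullet> ?Q = 0"
    then have "(\<lambda>(dq, dp). dp \<bullet> ?P + dq \<bullet> ?Q) = (\<lambda>_. 0)"
      by (simp only: case_prod_unfold)
    with D show "(H \<mu> has_derivative (\<lambda>_. 0)) (at (q, p))"
      by (simp only:)
  qed
  also have "\<dots> \<longleftrightarrow> ?P = 0 \<and> ?Q = 0"
    by (rule inner_add_inner_eq_0_iff)
  also have "?P = 0 \<longleftrightarrow> p = - (\<i> * (q - of_real \<mu>))"
    by (simp add: eq_neg_iff_add_eq_0)
  also have "p = - (\<i> * (q - of_real \<mu>)) \<and> ?Q = 0 \<longleftrightarrow> p = - (\<i> * (q - of_real \<mu>)) \<and>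
    of_real (1 - \<mu>) * of_real (1 / cmod q ^ 3 - 1) * q + of_real \<mu> * of_real (1 / cmod (q - 1) ^ 3 - 1) * (q - 1) = 0"
    by (rule conj_cong[OF refl], subst Q, assumption, rule refl)
  finally show ?thesis
    using False unfolding critical_points_def by blast
qed (auto simp: critical_points_def)

text \<open>Completing the square gives \<open>H\<close> as |p + i(q - \<mu>)|^2 / 2 minus the
  effective potential; here the square vanishes.\<close>

lemma H_on_zero_velocity:
  "H \<mu> (q, - (\<i> * (q - of_real \<mu>))) = - ((cmod (q - of_real \<mu>))\<^sup>2 / 2 + (1 - \<mu>) / cmod q + \<mu> / cmod (q - 1))"
proof -
  have "cmod (- (\<i> * (q - of_real \<mu>))) = cmod (q - of_real \<mu>)"
    by (simp add: norm_mult)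
  moreover have "(- (\<i> * (q - of_real \<mu>))) \<bullet> (\<i> * q) - (- (\<i> * (q - of_real \<mu>))) \<bullet> (\<i> * of_real \<mu>)
     = - (cmod (q - of_real \<mu>))\<^sup>2"
    unfolding cmod_power2 by (simp add: inner_complex_def power2_eq_square algebra_simps)
  ultimately show ?thesis
    by (simp add: H_def)
qed

text \<open>One triangular point suffices to make the set under the infimum in \<open>H_L1\<close>
  nonempty.\<close>

lemma equilateral_critical_point:
  "\<exists>p. (Complex (1/2) (sqrt 3 / 2), p) \<in> critical_points \<mu>"
proof -
  have "cmod (Complex (1/2) (sqrt 3 / 2)) = 1" "cmod (Complex (1/2) (sqrt 3 / 2) - 1) = 1"
    by (simp_all add: cmod_def power_divide)
  moreover from this have "Complex (1/2) (sqrt 3 / 2) \<noteq> 0" "Complex (1/2) (sqrt 3 / 2) \<noteq> 1"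
    by auto
  ultimately show ?thesis
    by (auto simp: critical_points_iff)
qed

text \<open>The function 1/|x| is convex on each half-line, so it lies above its tangents
  there.\<close>

lemma inverse_abs_tangent:
  fixes x t :: real
  assumes "x * t > 0"
  shows "1 / \<bar>x\<bar> - (t - x) * x / \<bar>x\<bar> ^ 3 \<le> 1 / \<bar>t\<bar>"
proof -
  have tangent: "1 / x - (t - x) * x / x ^ 3 \<le> 1 / t" if "x > 0" "t > 0" for x t :: real
  proof -
    have "1 / t - (1 / x - (t - x) * x / x ^ 3) = (t - x)\<^sup>2 / (t * x\<^sup>2)"
      using that by (simp add: field_simps power2_eq_square power3_eq_cube)
    moreover have "(t - x)\<^sup>2 / (t * x\<^sup>2) \<ge> 0" using that by simp
    ultimately show ?thesis by linarith
  qed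
  consider "x > 0" "t > 0" | "- x > 0" "- t > 0"
    using assms by (auto simp: zero_less_mult_iff)
  then show ?thesis
    by cases (use tangent[of x t] tangent[of "-x" "-t"] in \<open>auto simp: algebra_simps\<close>)
qed

definition axis_potential :: "real \<Rightarrow> real \<Rightarrow> real" where
  "axis_potential \<mu> t = (t - \<mu>)\<^sup>2 / 2 + (1 - \<mu>) / \<bar>t\<bar> + \<mu> / \<bar>t - 1\<bar>"

text \<open>\<open>axis_potential\<close> is convex between two singularities, so a critical point is a minimum there.\<close>

lemma axis_potential_min:
  assumes "0 < \<mu>" "\<mu> < 1" "x * t > 0" "(x - 1) * (t - 1) > 0"
    and crit: "(1 - \<mu>) * (1 / \<bar>x\<bar> ^ 3 - 1) * x + \<mu> * (1 / \<bar>x - 1\<bar> ^ 3 - 1) * (x - 1) = 0"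
  shows "axis_potential \<mu> x \<le> axis_potential \<mu> t"
proof -
  have "(1 - \<mu>) * (1 / \<bar>x\<bar> - (t - x) * x / \<bar>x\<bar> ^ 3) \<le> (1 - \<mu>) * (1 / \<bar>t\<bar>)"
    using inverse_abs_tangent[OF assms(3)] assms(2) by (intro mult_left_mono) auto
  moreover have "\<mu> * (1 / \<bar>x - 1\<bar> - (t - x) * (x - 1) / \<bar>x - 1\<bar> ^ 3) \<le> \<mu> * (1 / \<bar>t - 1\<bar>)"
    using inverse_abs_tangent[OF assms(4)] assms(1) by (intro mult_left_mono) auto
  moreover have "(x - \<mu>)\<^sup>2 / 2 + (x - \<mu>) * (t - x) \<le> (t - \<mu>)\<^sup>2 / 2"
  proof -
    have "(t - \<mu>)\<^sup>2 / 2 = (x - \<mu>)\<^sup>2 / 2 + (x - \<mu>) * (t - x) + (t - x)\<^sup>2 / 2"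
      by (simp add: power2_eq_square field_simps)
    then show ?thesis using zero_le_power2[of "t - x"] by linarith
  qed
  moreover have "(t - x) * ((1 - \<mu>) * (1 / \<bar>x\<bar> ^ 3 - 1) * x + \<mu> * (1 / \<bar>x - 1\<bar> ^ 3 - 1) * (x - 1)) = 0"
    unfolding crit by simp
  ultimately show ?thesis
    unfolding axis_potential_def by (simp add: algebra_simps)
qed

text \<open>For nonreal q the numbers q and q - 1 are linearly independent over the reals, so both
  real coefficients vanish and |q| = |q - 1| = 1. Then |q - \<mu>| is at most 1 and the potential at
  most 1/2 + 1.\<close>

lemma H_critical_off_axis:
  assumes "0 < \<mu>" "\<mu> < 1" "(q, p) \<in> critical_points \<mu>" "Im q \<noteq> 0"
  shows "H \<mu> (q, p) \<ge> - (3 / 2)"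
proof -
  define A where "A = (1 - \<mu>) * (1 / cmod q ^ 3 - 1)"
  define B where "B = \<mu> * (1 / cmod (q - 1) ^ 3 - 1)"
  have p: "p = - (\<i> * (q - of_real \<mu>))" and eq: "of_real A * q + of_real B * (q - 1) = 0"
    using assms(3) by (simp_all add: critical_points_iff A_def B_def)
  have "A + B = 0"
    using arg_cong[OF eq, of Im] assms(4) by (simp flip: distrib_right)
  moreover have "(A + B) * Re q = B"
    using arg_cong[OF eq, of Re] by (simp add: algebra_simps)
  ultimately have "A = 0" "B = 0" by auto
  then have "cmod q ^ 3 = 1" "cmod (q - 1) ^ 3 = 1"
    using assms(1,2) by (auto simp: A_def B_def)
  then have n: "cmod q = 1" "cmod (q - 1) = 1"
    using power_eq_imp_eq_base[of "cmod q" 3 1] power_eq_imp_eq_base[of "cmod (q - 1)" 3 1] by simp_all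
  then have "(Re q)\<^sup>2 + (Im q)\<^sup>2 = 1" "(Re q - 1)\<^sup>2 + (Im q)\<^sup>2 = 1"
    by (simp_all add: cmod_def)
  then have "(cmod (q - of_real \<mu>))\<^sup>2 = 1 - \<mu> * (1 - \<mu>)"
    unfolding cmod_power2 by (simp add: power2_eq_square algebra_simps)
  moreover have "0 \<le> \<mu> * (1 - \<mu>)" using assms(1,2) by simp
  ultimately have "(cmod (q - of_real \<mu>))\<^sup>2 \<le> 1" by linarith
  then show ?thesis
    unfolding p H_on_zero_velocity n by simp
qed

text \<open>The test points s, -s and 2 lie one in each interval of the real axis cut at the two
  primaries.\<close>

lemma H_critical_lower_bound:
  assumes "0 < \<mu>" "\<mu> < 1" "0 < s" "s < 1" "3 / 2 \<le> b"
    and "axis_potential \<mu> s \<le> b" "axis_potential \<mu> (- s) \<le> b" "axis_potential \<mu> 2 \<le> b"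
    and crit: "(q, p) \<in> critical_points \<mu>"
  shows "H \<mu> (q, p) \<ge> - b"
proof (cases "Im q = 0")
  case True
  define x where "x = Re q"
  have q: "q = of_real x" using True by (simp add: x_def complex_eq_iff)
  have abs: "cmod q = \<bar>x\<bar>" "cmod (q - 1) = \<bar>x - 1\<bar>" "cmod (q - of_real \<mu>) = \<bar>x - \<mu>\<bar>"
    unfolding q by (metis norm_of_real of_real_1 of_real_diff)+
  have p: "p = - (\<i> * (q - of_real \<mu>))" and x: "x \<noteq> 0" "x \<noteq> 1"
    and "of_real (1 - \<mu>) * of_real (1 / cmod q ^ 3 - 1) * q + of_real \<mu> * of_real (1 / cmod (q - 1) ^ 3 - 1) * (q - 1) = 0"
    using crit by (auto simp: critical_points_iff q)
  from arg_cong[OF this(4), of Re]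
  have "(1 - \<mu>) * (1 / \<bar>x\<bar> ^ 3 - 1) * x + \<mu> * (1 / \<bar>x - 1\<bar> ^ 3 - 1) * (x - 1) = 0"
    unfolding abs by (simp add: q)
  note min = axis_potential_min[OF assms(1,2) _ _ this]
  consider "x < 0" | "0 < x" "x < 1" | "1 < x" using x by linarith
  then have "axis_potential \<mu> x \<le> b"
  proof cases
    case 1
    then have "axis_potential \<mu> x \<le> axis_potential \<mu> (- s)"
      using assms(3) by (intro min mult_neg_neg) auto
    then show ?thesis using assms(7) by simp
  next
    case 2
    then have "axis_potential \<mu> x \<le> axis_potential \<mu> s"
      using assms(3,4) by (intro min[OF mult_pos_pos mult_neg_neg]) auto
    then show ?thesis using assms(6) by simp
  next
    case 3
    then show ?thesis using min[of 2] assms(8) by simp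
  qed
  then show ?thesis
    unfolding p H_on_zero_velocity abs axis_potential_def by simp
next
  case False
  then show ?thesis using H_critical_off_axis[OF assms(1,2) crit] assms(5) by simp
qed

lemma eventually_H_L1_gt:
  assumes "c > 3 / 2"
  shows "\<forall>\<^sub>F \<mu> in at_left 1. - c < H_L1 \<mu>"
proof -
  \<comment> \<open>The infimum keeps only a non-strict bound; the final strict inequality comes
    from b < c.\<close>
  define b where "b = (c + 3 / 2) / 2"
  have b: "3 / 2 < b" "b < c" using assms by (simp_all add: b_def)
  \<comment> \<open>The test point sqrt(1 - \<mu>) tends to 0 slowly enough that the earth term,
    again sqrt(1 - \<mu>), vanishes in the limit; what remains is 1/2 + 1.\<close>
  have "((\<lambda>\<mu>. axis_potential \<mu> (sqrt (1 - \<mu>))) \<longlongrightarrow> 3 / 2) (at_left 1)"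
    unfolding axis_potential_def by real_asymp
  then have 1: "\<forall>\<^sub>F \<mu> in at_left 1. axis_potential \<mu> (sqrt (1 - \<mu>)) < b"
    using b(1) by (rule order_tendstoD)
  have "((\<lambda>\<mu>. axis_potential \<mu> (- sqrt (1 - \<mu>))) \<longlongrightarrow> 3 / 2) (at_left 1)"
    unfolding axis_potential_def by real_asymp
  then have 2: "\<forall>\<^sub>F \<mu> in at_left 1. axis_potential \<mu> (- sqrt (1 - \<mu>)) < b"
    using b(1) by (rule order_tendstoD)
  have "((\<lambda>\<mu>. axis_potential \<mu> 2) \<longlongrightarrow> 3 / 2) (at_left 1)"
    unfolding axis_potential_def by real_asymp
  then have 3: "\<forall>\<^sub>F \<mu> in at_left 1. axis_potential \<mu> 2 < b"
    using b(1) by (rule order_tendstoD)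
  have 4: "\<forall>\<^sub>F \<mu> in at_left (1::real). \<mu> \<in> {0<..<1}"
    by (rule eventually_at_left_real) simp
  show ?thesis
    using 1 2 3 4
  proof eventually_elim
    case (elim \<mu>)
    have "- b \<le> H_L1 \<mu>"
      unfolding H_L1_def
    proof (rule cInf_greatest)
      show "H \<mu> ` critical_points \<mu> \<noteq> {}"
        using equilateral_critical_point by blast
    next
      fix y assume "y \<in> H \<mu> ` critical_points \<mu>"
      then obtain q p where "y = H \<mu> (q, p)" "(q, p) \<in> critical_points \<mu>" by auto
      then show "- b \<le> y"
        using H_critical_lower_bound[of \<mu> "sqrt (1 - \<mu>)" b q p] elim b by auto
    qed
    with b show ?case by simp
  qed
qed

section \<open>The component around the earth\<close>

lemma ex_K_extension_strongly_convex:
  assumes "c > 3 / 2"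
  obtains m r where "m > 0" "0 < r" "r \<le> 1 / 2" "\<And>\<mu>. smooth_on UNIV (K_extension \<mu> c r)"
    "\<And>\<mu> z h. 0 \<le> \<mu> \<Longrightarrow> \<mu> \<le> 1 \<Longrightarrow> m * (norm h)\<^sup>2 \<le> hessian (K_extension \<mu> c r) z h h"
proof -
  \<comment> \<open>Half of the bound for the quadratic Hessian; the other half absorbs the two
    cut-off parts, m/2 each.\<close>
  define m where "m = (2 * c - 3) / (2 * c - 1) / 2"
  have m: "m > 0" using assms by (simp add: m_def)
  have outside: "quartic_part (s, z) = 0" "potential_part (s, z) = 0" if "norm z > 3 / 2" for s z
  proof -
    have "(3 / 2)\<^sup>2 \<le> (norm z)\<^sup>2" using that by (intro power_mono) auto
    then have "cutoff ((norm z)\<^sup>2) = 0" by (intro cutoff_eq_0) (simp add: power_divide)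
    then show "quartic_part (s, z) = 0" "potential_part (s, z) = 0"
      by (simp_all add: quartic_part_def potential_part_def case_prod_unfold)
  qed
  have zero: "quartic_part (0, z) = 0" "potential_part (0, z) = 0" for z
    by (simp_all add: quartic_part_def potential_part_def case_prod_unfold)
  have m2: "m / 2 > 0" using m by simp
  obtain s1 where s1: "0 < s1" "s1 \<le> 1 / 8"
    "\<And>s z h. \<bar>s\<bar> < s1 \<Longrightarrow> \<bar>hessian quartic_part (s, z) (0, h) (0, h)\<bar> \<le> m / 2 * (norm h)\<^sup>2"
    using hessian_slice_small[OF _ smooth_on_subset[OF smooth_on_quartic_part subset_UNIV] zero(1) outside(1) m2, of "1 / 8"]
    by auto
  obtain s2 where s2: "0 < s2" "s2 \<le> 1 / 8"
    "\<And>s z h. \<bar>s\<bar> < s2 \<Longrightarrow> \<bar>hessian potential_part (s, z) (0, h) (0, h)\<bar> \<le> m / 2 * (norm h)\<^sup>2"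
    using hessian_slice_small[OF _ smooth_on_potential_part zero(2) outside(2) m2] by auto
  \<comment> \<open>One scale for all \<mu>, with r^2 strictly below both thresholds.\<close>
  define r where "r = sqrt (min s1 s2 / 2)"
  have r: "r > 0" "r\<^sup>2 < s1" "r\<^sup>2 < s2" "r\<^sup>2 < 1 / 8"
    using s1(1,2) s2(1,2) by (auto simp: r_def)
  have "r\<^sup>2 \<le> (1 / 2)\<^sup>2" using r(4) by (simp add: power_divide)
  then have "r \<le> 1 / 2" by (rule power2_le_imp_le) simp
  moreover have "m * (norm h)\<^sup>2 \<le> hessian (K_extension \<mu> c r) z h h" if \<mu>: "0 \<le> \<mu>" "\<mu> \<le> 1" for \<mu> z h
  proof -
    let ?q = "hessian quartic_part (r\<^sup>2, z /\<^sub>R r) (0, h) (0, h)"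
    let ?p = "hessian potential_part (r\<^sup>2, z /\<^sub>R r) (0, h) (0, h)"
    have "\<mu> * ?p \<le> 1 * \<bar>?p\<bar>"
      using \<mu> by (intro order_trans[OF mult_left_mono mult_right_mono]) auto
    moreover have "\<bar>?p\<bar> \<le> m / 2 * (norm h)\<^sup>2" "\<bar>?q\<bar> \<le> m / 2 * (norm h)\<^sup>2"
      by (rule s1(3) s2(3), use r in simp)+
    moreover have "2 * m * (norm h)\<^sup>2 \<le> 2 * K_quadratic \<mu> c h"
    proof -
      have "2 * m = (2 * c - 3) / (2 * c - 1)" unfolding m_def by (rule field_sum_of_halves[folded mult_2])
      then show ?thesis using K_quadratic_lower_bound[OF assms \<mu>, of h] by (simp only:)
    qed
    ultimately show ?thesis
      using smooth_on_K_extension(2)[OF r(4), of \<mu> c z h] r(1) by (simp add: algebra_simps)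
  qed
  ultimately show thesis
    using that m r(1) smooth_on_K_extension(1)[OF r(4)] by blast
qed

text \<open>\<open>S\<close> is open in \<open>Z\<close> by the last assumption and closed by
  compactness, so no connected subset of \<open>Z\<close> can properly contain it.\<close>

lemma component_eqI:
  assumes "compact S" "connected S" "S \<noteq> {}" "open U" "S = Z \<inter> U"
  shows "S \<in> components (Z :: 'a::t2_space set)"
proof -
  obtain T where T: "T \<in> components Z" "S \<subseteq> T"
    using exists_component_superset[of S Z] assms by auto
  have "T \<subseteq> Z" "connected T"
    using T(1) in_components_subset in_components_connected by blast+
  have "T \<subseteq> S"
  proof (rule ccontr)
    assume "\<not> T \<subseteq> S"
    then have "- S \<inter> T \<noteq> {}" by blast
    moreover have "U \<inter> T \<noteq> {}" using T(2) assms(3,5) by blast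
    moreover have "T \<subseteq> U \<union> - S" "U \<inter> - S \<inter> T = {}" using \<open>T \<subseteq> Z\<close> assms(5) by blast+
    moreover have "open (- S)" using compact_imp_closed[OF assms(1)] by (simp add: open_Compl)
    ultimately show False
      using connectedD[OF \<open>connected T\<close> assms(4)] by blast
  qed
  with T show ?thesis by (metis subset_antisym)
qed

text \<open>The bound on (1 - \<mu>)/m confines the level set to the ball of radius r, where the
  extension is 1 + K; the bound on 1 - \<mu> does so for the collision circle. With r at most 1/2,
  |2 v^2| < 1 keeps away from the sun.\<close>

lemma Sigma_comp_eq_level:
  assumes "m > 0" "0 < r" "r \<le> 1 / 2" "smooth_on UNIV (K_extension \<mu> c r)"
    and hess: "\<And>z h. m * (norm h)\<^sup>2 \<le> hessian (K_extension \<mu> c r) z h h"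
    and \<mu>: "0 < \<mu>" "\<mu> < 1" "(1 - \<mu>) / m < r\<^sup>2" "1 - \<mu> < r\<^sup>2"
  shows "Sigma_comp \<mu> c = K_extension \<mu> c r -` {1}"
    and "bounds_strongly_convex_domain (K_extension \<mu> c r -` {1})"
proof -
  let ?C = "K_extension \<mu> c r"
  let ?S = "?C -` {1}"
  have C0: "?C 0 < 1" using \<mu> by (simp add: K_extension_0)
  note level = assms(4,1) hess K_extension_minus C0
  show bounds: "bounds_strongly_convex_domain ?S"
    by (rule bounds_strongly_convex_domain_level[OF level])
  have S: "?S = K_zero_set \<mu> c \<inter> ball 0 r"
  proof (intro set_eqI iffI)
    fix z assume z: "z \<in> ?S"
    then have "m / 2 * (norm z)\<^sup>2 \<le> (1 - \<mu>) / 2"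
      using level_set_norm_bound[OF level, of z] by (simp add: K_extension_0)
    then have "(norm z)\<^sup>2 \<le> (1 - \<mu>) / m" using assms(1) by (simp add: field_simps)
    then have "(norm z)\<^sup>2 < r\<^sup>2" using \<mu>(3) by simp
    then have n: "norm z < r" using assms(2) by (simp add: power_less_imp_less_base)
    obtain v u where vu: "z = (v, u)" by (cases z)
    have "cmod v \<le> 1 / 2" using n assms(3) norm_fst_le[of v u] by (simp add: vu)
    then have "(cmod v)\<^sup>2 \<le> (1 / 2)\<^sup>2" by (intro power_mono) auto
    then have "cmod (2 * v\<^sup>2) < cmod 1" by (simp add: norm_mult norm_power power_divide)
    then have "2 * v\<^sup>2 \<noteq> 1" by (metis less_irrefl)
    moreover have "K \<mu> c z = 0" using z n K_extension_eq_K[OF assms(2), of z \<mu> c] by simp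
    ultimately show "z \<in> K_zero_set \<mu> c \<inter> ball 0 r"
      using n by (simp add: K_zero_set_def vu)
  next
    fix z assume "z \<in> K_zero_set \<mu> c \<inter> ball 0 r"
    then show "z \<in> ?S"
      using K_extension_eq_K[OF assms(2), of z \<mu> c] by (auto simp: K_zero_set_def)
  qed
  have circle: "collision_circle \<mu> \<subseteq> ?S"
  proof
    fix z assume z: "z \<in> collision_circle \<mu>"
    then have "(norm z)\<^sup>2 < r\<^sup>2"
      using \<mu>(4) by (auto simp: collision_circle_def norm_prod_power2)
    then have "norm z < r" using assms(2) by (simp add: power_less_imp_less_base)
    moreover have "z \<in> K_zero_set \<mu> c"
      using z by (auto simp: collision_circle_def K_zero_set_def K_def)
    ultimately show "z \<in> ?S" unfolding S by simp
  qed
  have "(0, of_real (sqrt (1 - \<mu>))) \<in> collision_circle \<mu>"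
    using \<mu>(2) by (simp add: collision_circle_def)
  then have "?S \<noteq> {}" using circle by blast
  moreover have "connected ?S"
    by (rule connected_level[OF level]) simp
  moreover have "compact ?S"
    using bounds by (simp add: bounds_strongly_convex_domain_def)
  ultimately have "?S \<in> components (K_zero_set \<mu> c)"
    using S by (intro component_eqI[OF _ _ _ open_ball])
  then show "Sigma_comp \<mu> c = ?S"
    unfolding Sigma_comp_def using circle by (intro the1_equality[OF Sigma_comp_unique[OF \<mu>(2)]]) simp
qed

text \<open>Since m and r are chosen before \<mu>, both smallness conditions hold once \<mu> is
  close to 1.\<close>

lemma eventually_bounds_strongly_convex:
  assumes "c > 3 / 2"
  shows "\<forall>\<^sub>F \<mu> in at_left 1. bounds_strongly_convex_domain (Sigma_comp \<mu> c)"
proof -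
  obtain m r where mr: "m > 0" "0 < r" "r \<le> 1 / 2" "\<And>\<mu>. smooth_on UNIV (K_extension \<mu> c r)"
    "\<And>\<mu> z h. 0 \<le> \<mu> \<Longrightarrow> \<mu> \<le> 1 \<Longrightarrow> m * (norm h)\<^sup>2 \<le> hessian (K_extension \<mu> c r) z h h"
    using ex_K_extension_strongly_convex[OF assms] by metis
  have "((\<lambda>\<mu>::real. (1 - \<mu>) / m) \<longlongrightarrow> (1 - 1) / m) (at_left 1)"
    using mr(1) by (intro tendsto_intros) simp
  then have 1: "\<forall>\<^sub>F \<mu> in at_left 1. (1 - \<mu>) / m < r\<^sup>2"
    using mr(2) by (intro order_tendstoD) auto
  have "((\<lambda>\<mu>::real. 1 - \<mu>) \<longlongrightarrow> 1 - 1) (at_left 1)"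
    by (intro tendsto_intros)
  then have 2: "\<forall>\<^sub>F \<mu> in at_left 1. 1 - \<mu> < r\<^sup>2"
    using mr(2) by (intro order_tendstoD) auto
  have 3: "\<forall>\<^sub>F \<mu> in at_left (1::real). \<mu> \<in> {0<..<1}"
    by (rule eventually_at_left_real) simp
  show ?thesis
    using 1 2 3
  proof eventually_elim
    case (elim \<mu>)
    then have hess: "m * (norm h)\<^sup>2 \<le> hessian (K_extension \<mu> c r) z h h" for z h
      by (intro mr(5)) auto
    show ?case
      using Sigma_comp_eq_level[OF mr(1-4) hess] elim by auto
  qed
qed

theorem proposition1p2:
  shows "\<exists>\<mu>\<^sub>0 :: real \<Rightarrow> real.
    (\<forall>c>3/2. 0 < \<mu>\<^sub>0 c \<and> \<mu>\<^sub>0 c < 1) \<and>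
    {(c, \<mu>) | c \<mu>. c > 3/2 \<and> \<mu>\<^sub>0 c < \<mu> \<and> \<mu> < 1} \<subseteq> convexity_range"
proof -
  have "\<exists>b. 0 < b \<and> b < 1 \<and> (\<forall>\<mu>. b < \<mu> \<and> \<mu> < 1 \<longrightarrow> (c, \<mu>) \<in> convexity_range)" if c: "c > 3 / 2" for c
  proof -
    have "\<forall>\<^sub>F \<mu> in at_left 1. (c, \<mu>) \<in> convexity_range"
      using eventually_H_L1_gt[OF c] eventually_bounds_strongly_convex[OF c]
        eventually_at_left_real[OF zero_less_one]
      by eventually_elim (use c in \<open>simp add: convexity_range_def\<close>)
    then obtain b where b: "b < 1" "\<And>\<mu>. b < \<mu> \<Longrightarrow> \<mu> < 1 \<Longrightarrow> (c, \<mu>) \<in> convexity_range"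
      unfolding eventually_at_left_field by blast
    show ?thesis
      \<comment> \<open>The bound from the filter may be nonpositive; the maximum with 1/2 makes it
        positive.\<close>
      by (rule exI[of _ "max b (1 / 2)"]) (use b in auto)
  qed
  then obtain \<mu>\<^sub>0 where "\<And>c. c > 3 / 2 \<Longrightarrow> 0 < \<mu>\<^sub>0 c \<and> \<mu>\<^sub>0 c < 1 \<and>
      (\<forall>\<mu>. \<mu>\<^sub>0 c < \<mu> \<and> \<mu> < 1 \<longrightarrow> (c, \<mu>) \<in> convexity_range)"
    by metis
  then show ?thesis
    by (intro exI[of _ \<mu>\<^sub>0]) auto
qed

end
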